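(* Let $\mathcal K$ be a Fraïssé class and $\mathbf K$ its Fraïssé limit. Then the following are equivalent: (i) $\mathbf K$ has a generic automorphism; (ii) $\mathcal K_p$ satisfies the joint embedding property (JEP) and the weak amalgamation property (WAP).
   Context: Fix a countable first-order signature $L$. A class $\mathcal K$ of finite $L$-structures is a Fraïssé class if: (HP) whenever $\mathbf A$ embeds in $\mathbf B\in\mathcal K$, then $\mathbf A\in\mathcal K$; (JEP) any $\mathbf A,\mathbf B\in\mathcal K$ both embed in some $\mathbf C\in\mathcal K$; (AP) for embeddings $f:\mathbf A\to\mathbf B$, $g:\mathbf A\to\mathbf C$ with $\mathbf A,\mathbf B,\mathbf C\in\mathcal K$ there are $\mathbf D\in\mathcal K$ and embeddings $r:\mathbf B\to\mathbf D$, $s:\mathbf C\to\mathbf D$ with $r\circ f=s\circ g$; and $\mathcal K$ contains only countably many structures up to isomorphism and structures of arbitrarily large finite cardinality. Its Fraïssé limit $\mathbf K$ is the unique (up to isomorphism) countably infinite structure that is locally finite (finitely generated substructures are finite), ultrahomogeneous (any isomorphism between finite substructures extends to an automorphism), and for which $\mathcal K$ is exactly the class of finite structures embeddable in $\mathbf K$. The Polish group $\mathrm{Aut}(\mathbf K)$ carries the pointwise convergence topology ($\mathbf K$ discrete). A generic automorphism of $\mathbf K$ is an element of $\mathrm{Aut}(\mathbf K)$ whose conjugacy class is dense $G_\delta$ (equivalently, comeager). $\mathcal K_p$ is the class of all systems $\mathcal S=\langle\mathbf A,\psi:\mathbf B\to\mathbf C\rangle$, where $\mathbf A,\mathbf B,\mathbf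 C\in\mathcal K$, $\mathbf B,\mathbf C\subseteq\mathbf A$ are substructures and $\psi$ is an isomorphism of $\mathbf B$ onto $\mathbf C$. An embedding of $\mathcal S$ into $\mathcal T=\langle\mathbf D,\varphi:\mathbf E\to\mathbf F\rangle$ is an embedding $f:\mathbf A\to\mathbf D$ that maps $\mathbf B$ into $\mathbf E$ and $\mathbf C$ into $\mathbf F$ and satisfies $f\circ\psi\subseteq\varphi\circ f$ (i.e. $f(\psi(b))=\varphi(f(b))$ for all $b\in\mathbf B$). JEP for $\mathcal K_p$: any two systems in $\mathcal K_p$ embed in a common system in $\mathcal K_p$. WAP for $\mathcal K_p$: for every $\mathcal S\in\mathcal K_p$ there are $\mathcal T\in\mathcal K_p$ and an embedding $e:\mathcal S\to\mathcal T$ such that for any embeddings $f:\mathcal T\to\mathcal T_0$, $g:\mathcal T\to\mathcal T_1$ with $\mathcal T_0,\mathcal T_1\in\mathcal K_p$ there are $\mathcal U\in\mathcal K_p$ and embeddings $r:\mathcal T_0\to\mathcal U$, $s:\mathcal T_1\to\mathcal U$ with $r\circ f\circ e=s\circ g\circ e$. *)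

theory Defs
  imports "HOL-Analysis.Analysis" "HOL-Algebra.Bij"
begin

section \<open>First-order structures\<close>

text \<open>Symbols are drawn from sets rather than from whole types, so that a signature may lack
  function symbols or relation symbols. Constants are function symbols of arity 0.\<close>

record ('f, 'r) signature =
  funs :: "'f set"
  rels :: "'r set"
  farity :: "'f \<Rightarrow> nat"
  rarity :: "'r \<Rightarrow> nat"

definition countable_signature :: "('f, 'r) signature \<Rightarrow> bool" where
  "countable_signature L \<longleftrightarrow> countable (funs L) \<and> countable (rels L)"

record ('f, 'r, 'a) struct =
  univ :: "'a set"
  finterp :: "'f \<Rightarrow> 'a list \<Rightarrow> 'a"
  rinterp :: "'r \<Rightarrow> 'a list \<Rightarrow> bool"

definition tuples :: "nat \<Rightarrow> ('f, 'r, 'a) struct \<Rightarrow> 'a list set" where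
  "tuples n A = {xs. length xs = n \<and> set xs \<subseteq> univ A}"

text \<open>The empty universe is allowed (it occurs only if there are no constants). The interpretations
  are relevant only on tuples of the right length over the universe; every notion below ignores
  their values elsewhere.\<close>

definition L_structure :: "('f, 'r) signature \<Rightarrow> ('f, 'r, 'a) struct \<Rightarrow> bool" where
  "L_structure L A \<longleftrightarrow> (\<forall>F\<in>funs L. \<forall>xs\<in>tuples (farity L F) A. finterp A F xs \<in> univ A)"

text \<open>Maps between structures are considered on the universe of the source only; they are
  not assumed to be extensional.\<close>

definition embedding ::
  "('f, 'r) signature \<Rightarrow> ('f, 'r, 'a) struct \<Rightarrow> ('f, 'r, 'b) struct \<Rightarrow> ('a \<Rightarrow> 'b) \<Rightarrow> bool" where
  "embedding L A B h \<longleftrightarrow>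
     h ` univ A \<subseteq> univ B \<and> inj_on h (univ A) \<and>
     (\<forall>F\<in>funs L. \<forall>xs\<in>tuples (farity L F) A. h (finterp A F xs) = finterp B F (map h xs)) \<and>
     (\<forall>R\<in>rels L. \<forall>xs\<in>tuples (rarity L R) A. rinterp A R xs \<longleftrightarrow> rinterp B R (map h xs))"

definition embeds ::
  "('f, 'r) signature \<Rightarrow> ('f, 'r, 'a) struct \<Rightarrow> ('f, 'r, 'b) struct \<Rightarrow> bool" where
  "embeds L A B \<longleftrightarrow> (\<exists>h. embedding L A B h)"

definition isomorphism ::
  "('f, 'r) signature \<Rightarrow> ('f, 'r, 'a) struct \<Rightarrow> ('f, 'r, 'b) struct \<Rightarrow> ('a \<Rightarrow> 'b) \<Rightarrow> bool" where
  "isomorphism L A B h \<longleftrightarrow> embedding L A B h \<and> h ` univ A = univ B"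

definition isomorphic ::
  "('f, 'r) signature \<Rightarrow> ('f, 'r, 'a) struct \<Rightarrow> ('f, 'r, 'b) struct \<Rightarrow> bool" where
  "isomorphic L A B \<longleftrightarrow> (\<exists>h. isomorphism L A B h)"

definition substructure ::
  "('f, 'r) signature \<Rightarrow> ('f, 'r, 'a) struct \<Rightarrow> ('f, 'r, 'a) struct \<Rightarrow> bool" where
  "substructure L B A \<longleftrightarrow>
     L_structure L B \<and> L_structure L A \<and> univ B \<subseteq> univ A \<and>
     (\<forall>F\<in>funs L. \<forall>xs\<in>tuples (farity L F) B. finterp B F xs = finterp A F xs) \<and>
     (\<forall>R\<in>rels L. \<forall>xs\<in>tuples (rarity L R) B. rinterp B R xs \<longleftrightarrow> rinterp A R xs)"

text \<open>The universe of the substructure generated by \<open>S\<close>.\<close>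

inductive_set generated ::
  "('f, 'r) signature \<Rightarrow> ('f, 'r, 'a) struct \<Rightarrow> 'a set \<Rightarrow> 'a set"
  for L :: "('f, 'r) signature" and M :: "('f, 'r, 'a) struct" and S :: "'a set" where
  base: "x \<in> S \<Longrightarrow> x \<in> generated L M S"
| app: "F \<in> funs L \<Longrightarrow> length xs = farity L F \<Longrightarrow> (\<forall>x\<in>set xs. x \<in> generated L M S) \<Longrightarrow>
    finterp M F xs \<in> generated L M S"

definition locally_finite :: "('f, 'r) signature \<Rightarrow> ('f, 'r, 'a) struct \<Rightarrow> bool" where
  "locally_finite L M \<longleftrightarrow> (\<forall>S. finite S \<and> S \<subseteq> univ M \<longrightarrow> finite (generated L M S))"


section \<open>The automorphism group\<close>

definition Aut :: "('f, 'r) signature \<Rightarrow> ('f, 'r, 'a) struct \<Rightarrow> ('a \<Rightarrow> 'a) set" where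
  "Aut L M = {g \<in> Bij (univ M). isomorphism L M M g}"

definition Aut_group :: "('f, 'r) signature \<Rightarrow> ('f, 'r, 'a) struct \<Rightarrow> ('a \<Rightarrow> 'a) monoid" where
  "Aut_group L M = (BijGroup (univ M))\<lparr>carrier := Aut L M\<rparr>"

definition Aut_topology :: "('f, 'r) signature \<Rightarrow> ('f, 'r, 'a) struct \<Rightarrow> ('a \<Rightarrow> 'a) topology" where
  "Aut_topology L M =
     subtopology (product_topology (\<lambda>_. discrete_topology (univ M)) (univ M)) (Aut L M)"

definition conjugacy_class :: "('g, 'm) monoid_scheme \<Rightarrow> 'g \<Rightarrow> 'g set" where
  "conjugacy_class G x = {g \<otimes>\<^bsub>G\<^esub> x \<otimes>\<^bsub>G\<^esub> inv\<^bsub>G\<^esub> g | g. g \<in> carrier G}"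

definition generic_automorphism ::
  "('f, 'r) signature \<Rightarrow> ('f, 'r, 'a) struct \<Rightarrow> ('a \<Rightarrow> 'a) \<Rightarrow> bool" where
  "generic_automorphism L M f \<longleftrightarrow>
     f \<in> Aut L M \<and>
     Aut_topology L M closure_of conjugacy_class (Aut_group L M) f = topspace (Aut_topology L M) \<and>
     gdelta_in (Aut_topology L M) (conjugacy_class (Aut_group L M) f)"

definition ultrahomogeneous :: "('f, 'r) signature \<Rightarrow> ('f, 'r, 'a) struct \<Rightarrow> bool" where
  "ultrahomogeneous L M \<longleftrightarrow>
     (\<forall>A B \<phi>. substructure L A M \<and> substructure L B M \<and> finite (univ A) \<and> finite (univ B) \<and>
        isomorphism L A B \<phi> \<longrightarrow> (\<exists>g\<in>Aut L M. \<forall>x\<in>univ A. g x = \<phi> x))"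


section \<open>Fraisse classes and Fraisse limits\<close>

text \<open>Every finite structure is isomorphic to one with universe a subset of \<^typ>\<open>nat\<close>, so a class of
  finite structures closed under isomorphism is represented by a set of structures over \<^typ>\<open>nat\<close>.
  Closure under isomorphism is part of \<open>HP\<close>.\<close>

type_synonym ('f, 'r) class_of_structs = "('f, 'r, nat) struct set"

definition HP :: "('f, 'r) signature \<Rightarrow> ('f, 'r) class_of_structs \<Rightarrow> bool" where
  "HP L K \<longleftrightarrow> (\<forall>A B. L_structure L A \<and> B \<in> K \<and> embeds L A B \<longrightarrow> A \<in> K)"

definition JEP :: "('f, 'r) signature \<Rightarrow> ('f, 'r) class_of_structs \<Rightarrow> bool" where
  "JEP L K \<longleftrightarrow> (\<forall>A\<in>K. \<forall>B\<in>K. \<exists>C\<in>K. embeds L A C \<and> embeds L B C)"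

definition AP :: "('f, 'r) signature \<Rightarrow> ('f, 'r) class_of_structs \<Rightarrow> bool" where
  "AP L K \<longleftrightarrow>
     (\<forall>A\<in>K. \<forall>B\<in>K. \<forall>C\<in>K. \<forall>f g. embedding L A B f \<and> embedding L A C g \<longrightarrow>
        (\<exists>D\<in>K. \<exists>r s. embedding L B D r \<and> embedding L C D s \<and>
           (\<forall>x\<in>univ A. r (f x) = s (g x))))"

definition fraisse_class :: "('f, 'r) signature \<Rightarrow> ('f, 'r) class_of_structs \<Rightarrow> bool" where
  "fraisse_class L K \<longleftrightarrow>
     (\<forall>A\<in>K. L_structure L A \<and> finite (univ A)) \<and>
     HP L K \<and> JEP L K \<and> AP L K \<and>
     (\<exists>K0\<subseteq>K. countable K0 \<and> (\<forall>A\<in>K. \<exists>B\<in>K0. isomorphic L A B)) \<and>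
     (\<forall>n. \<exists>A\<in>K. n \<le> card (univ A))"

definition fraisse_limit ::
  "('f, 'r) signature \<Rightarrow> ('f, 'r) class_of_structs \<Rightarrow> ('f, 'r, 'a) struct \<Rightarrow> bool" where
  "fraisse_limit L K M \<longleftrightarrow>
     L_structure L M \<and> countable (univ M) \<and> infinite (univ M) \<and>
     locally_finite L M \<and> ultrahomogeneous L M \<and>
     K = {A. L_structure L A \<and> finite (univ A) \<and> embeds L A M}"


section \<open>Partial automorphisms of members of the class\<close>

record ('f, 'r) system =
  amb :: "('f, 'r, nat) struct"
  src :: "('f, 'r, nat) struct"
  tgt :: "('f, 'r, nat) struct"
  pmap :: "nat \<Rightarrow> nat"

definition Kp :: "('f, 'r) signature \<Rightarrow> ('f, 'r) class_of_structs \<Rightarrow> ('f, 'r) system set" where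
  "Kp L K = {S. amb S \<in> K \<and> src S \<in> K \<and> tgt S \<in> K \<and>
     substructure L (src S) (amb S) \<and> substructure L (tgt S) (amb S) \<and>
     isomorphism L (src S) (tgt S) (pmap S)}"

definition sys_embedding ::
  "('f, 'r) signature \<Rightarrow> ('f, 'r) system \<Rightarrow> ('f, 'r) system \<Rightarrow> (nat \<Rightarrow> nat) \<Rightarrow> bool" where
  "sys_embedding L S T f \<longleftrightarrow>
     embedding L (amb S) (amb T) f \<and>
     f ` univ (src S) \<subseteq> univ (src T) \<and> f ` univ (tgt S) \<subseteq> univ (tgt T) \<and>
     (\<forall>b\<in>univ (src S). f (pmap S b) = pmap T (f b))"

definition Kp_JEP :: "('f, 'r) signature \<Rightarrow> ('f, 'r) class_of_structs \<Rightarrow> bool" where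
  "Kp_JEP L K \<longleftrightarrow>
     (\<forall>S\<in>Kp L K. \<forall>T\<in>Kp L K. \<exists>U\<in>Kp L K.
        (\<exists>f. sys_embedding L S U f) \<and> (\<exists>g. sys_embedding L T U g))"

definition Kp_WAP :: "('f, 'r) signature \<Rightarrow> ('f, 'r) class_of_structs \<Rightarrow> bool" where
  "Kp_WAP L K \<longleftrightarrow>
     (\<forall>S\<in>Kp L K. \<exists>T\<in>Kp L K. \<exists>e. sys_embedding L S T e \<and>
        (\<forall>T0\<in>Kp L K. \<forall>T1\<in>Kp L K. \<forall>f g.
           sys_embedding L T T0 f \<and> sys_embedding L T T1 g \<longrightarrow>
           (\<exists>U\<in>Kp L K. \<exists>r s. sys_embedding L T0 U r \<and> sys_embedding L T1 U s \<and>
              (\<forall>x\<in>univ (amb S). r (f (e x)) = s (g (e x))))))"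

end

theory Submission
  imports Defs
begin

text \<open>Why the theorem holds. Write \<open>G\<close> for the automorphism group of the Fraisse limit \<open>M\<close>. A basic open
  subset of \<open>G\<close> is given by prescribing the values of an automorphism on a finite set. By
  ultrahomogeneity and local finiteness, prescribing such values is the same as specifying a finite
  partial automorphism of \<open>M\<close>, and up to isomorphism these are exactly the members of \<open>Kp\<close>. Both
  sides of the equivalence can therefore be compared with a dynamical condition on the action of
  \<open>G\<close> on itself by conjugation.

  Call a basic open set \<open>V\<close> mixing relative to a finite set \<open>A\<close> if conjugation by automorphisms
  fixing \<open>A\<close> pointwise can move some point of \<open>W0\<close> into \<open>W1\<close>, for any two basic open
  subsets \<open>W0\<close>, \<open>W1\<close> of \<open>V\<close>. The theorem splits into two independent parts.

  Topological part (\<open>dense_Gdelta_class_iff\<close>), valid for every closed permutation group of a countable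
  set: a dense Gdelta conjugacy class exists iff \<open>G\<close> is mixing relative to the empty set
  and, for every finite \<open>A\<close>, every basic open set contains one that is mixing relative to \<open>A\<close>.
  If a class \<open>C\<close> is dense Gdelta, density gives the first condition. For the second, the
  stabilizer of \<open>A\<close> has countable index, so \<open>C\<close> is a countable union of orbits of
  this stabilizer; by the Baire property one of them is somewhere dense, and a set in which an
  orbit is dense is mixing. Conversely, call \<open>f\<close> saturated if it lies in a mixing set relative to every
  \<open>A\<close> and if, within each mixing set containing it, conjugation by the stabilizer of \<open>A\<close> moves it into
  every basic open subset. These are countably many dense open conditions, invariant under conjugation,
  and a back-and-forth construction (\<open>saturated_conjugate_to_each_other\<close>) shows that any two saturated
  elements are conjugate. So the saturated elements form the required class.

  Model-theoretic part: \<open>Kp_JEP\<close> is the first mixing condition (\<open>mixing_iff_Kp_JEP\<close>) and \<open>Kp_WAP\<close> the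
  second (\<open>local_mixing_iff_Kp_WAP\<close>). Every system can be realized in \<open>M\<close> by an embedding of its
  ambient structure together with an automorphism extending its partial map, and a realization
  extends along embeddings of systems (\<open>realization_extends\<close>). Two placements of
  the same structure in \<open>M\<close> differ by an automorphism \<open>k\<close>, so embedding two systems in a common
  one means finding an automorphism that extends the first and whose conjugate by
  some \<open>k\<close> extends the second. If the two embeddings agree on the copy of \<open>A\<close>, then \<open>k\<close>
  fixes \<open>A\<close>; this is where amalgamation over a common part turns into mixing relative to \<open>A\<close>.\<close>

section \<open>Closed permutation groups and their conjugation action\<close>

text \<open>The last assumption says that \<open>G\<close> is closed in the group of all permutations of \<open>U\<close> with the
  topology of pointwise convergence. It is what makes limits of back-and-forth constructions
  belong to \<open>G\<close>. Elements are extensional on \<open>U\<close>, so they are determined by their values there.\<close>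

locale closed_permutation_group =
  fixes U :: "'a set" and G :: "('a \<Rightarrow> 'a) set"
  assumes countable_points: "countable U"
    and subgroup_BijGroup: "subgroup G (BijGroup U)"
    and pointwise_closed:
      "\<And>g. g \<in> Bij U \<Longrightarrow> (\<And>S. finite S \<Longrightarrow> S \<subseteq> U \<Longrightarrow> \<exists>h\<in>G. \<forall>x\<in>S. h x = g x) \<Longrightarrow> g \<in> G"
begin

definition inverse_perm :: "('a \<Rightarrow> 'a) \<Rightarrow> 'a \<Rightarrow> 'a" where
  "inverse_perm g = restrict (inv_into U g) U"

text \<open>The product \<open>k f k\<^sup>-\<^sup>1\<close>, in explicit form so that it can be evaluated pointwise.\<close>

definition conjugate :: "('a \<Rightarrow> 'a) \<Rightarrow> ('a \<Rightarrow> 'a) \<Rightarrow> 'a \<Rightarrow> 'a" where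
  "conjugate k f = compose U k (compose U f (inverse_perm k))"

definition nbhd :: "('a \<Rightarrow> 'a) \<Rightarrow> 'a set \<Rightarrow> ('a \<Rightarrow> 'a) set" where
  "nbhd h T = {g \<in> G. \<forall>x\<in>T. g x = h x}"

text \<open>A base of the topology of pointwise convergence. Its members are nonempty and clopen, and any
  member may serve as a centre.\<close>

definition basic :: "('a \<Rightarrow> 'a) set set" where
  "basic = {nbhd h T | h T. h \<in> G \<and> finite T \<and> T \<subseteq> U}"

definition stab :: "'a set \<Rightarrow> ('a \<Rightarrow> 'a) set" where
  "stab A = {k \<in> G. \<forall>x\<in>A. k x = x}"

text \<open>Topological transitivity of the conjugation action of the stabilizer of \<open>A\<close>, localized to \<open>V\<close>.\<close>

definition mixing :: "'a set \<Rightarrow> ('a \<Rightarrow> 'a) set \<Rightarrow> bool" where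
  "mixing A V \<longleftrightarrow> (\<forall>W0\<in>basic. \<forall>W1\<in>basic. W0 \<subseteq> V \<and> W1 \<subseteq> V \<longrightarrow>
     (\<exists>k\<in>stab A. \<exists>u\<in>W0. conjugate k u \<in> W1))"

lemma G_Bij: "g \<in> G \<Longrightarrow> g \<in> Bij U"
  using subgroup.subset[OF subgroup_BijGroup] by (auto simp: BijGroup_def)

lemma G_bij_betw: "g \<in> G \<Longrightarrow> bij_betw g U U"
  using G_Bij by (auto simp: Bij_def)

lemma G_in [simp]: "g \<in> G \<Longrightarrow> x \<in> U \<Longrightarrow> g x \<in> U"
  using G_bij_betw bij_betwE by metis

lemma G_inj: "g \<in> G \<Longrightarrow> x \<in> U \<Longrightarrow> y \<in> U \<Longrightarrow> g x = g y \<longleftrightarrow> x = y"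
  using G_bij_betw by (metis bij_betw_imp_inj_on inj_on_eq_iff)

lemma G_ext: "f \<in> G \<Longrightarrow> g \<in> G \<Longrightarrow> (\<And>x. x \<in> U \<Longrightarrow> f x = g x) \<Longrightarrow> f = g"
  by (meson Bij_imp_extensional G_Bij extensionalityI)

lemma G_id: "(\<lambda>x\<in>U. x) \<in> G"
  using subgroup.one_closed[OF subgroup_BijGroup] by (simp add: BijGroup_def)

lemma G_compose: "g \<in> G \<Longrightarrow> h \<in> G \<Longrightarrow> compose U g h \<in> G"
  using subgroup.m_closed[OF subgroup_BijGroup, of g h] by (simp add: BijGroup_def G_Bij)

lemma G_inverse: "g \<in> G \<Longrightarrow> inverse_perm g \<in> G"
  using subgroup.m_inv_closed[OF subgroup_BijGroup, of g]
  by (simp add: inv_BijGroup G_Bij inverse_perm_def)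

lemma inverse_left [simp]: "g \<in> G \<Longrightarrow> x \<in> U \<Longrightarrow> inverse_perm g (g x) = x"
  using G_bij_betw[of g] by (simp add: inverse_perm_def bij_betw_inv_into_left)

lemma inverse_right [simp]: "g \<in> G \<Longrightarrow> x \<in> U \<Longrightarrow> g (inverse_perm g x) = x"
  using G_bij_betw[of g] by (simp add: inverse_perm_def bij_betw_inv_into_right)

lemma inverse_in [simp]: "g \<in> G \<Longrightarrow> x \<in> U \<Longrightarrow> inverse_perm g x \<in> U"
  by (simp add: G_inverse)

lemma inverse_inverse [simp]:
  assumes "g \<in> G" shows "inverse_perm (inverse_perm g) = g"
proof (rule G_ext)
  fix x assume "x \<in> U"
  then show "inverse_perm (inverse_perm g) x = g x"
    using inverse_left[OF G_inverse[OF assms], of "g x"] assms by simp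
qed (use assms in \<open>auto intro: G_inverse\<close>)

lemma compose_at [simp]: "x \<in> U \<Longrightarrow> compose U g h x = g (h x)"
  by (simp add: compose_def)

lemma G_conjugate: "k \<in> G \<Longrightarrow> f \<in> G \<Longrightarrow> conjugate k f \<in> G"
  by (simp add: conjugate_def G_compose G_inverse)

lemma conjugate_at: "k \<in> G \<Longrightarrow> f \<in> G \<Longrightarrow> x \<in> U \<Longrightarrow> conjugate k f x = k (f (inverse_perm k x))"
  by (simp add: conjugate_def)

lemma conjugate_apply: "k \<in> G \<Longrightarrow> f \<in> G \<Longrightarrow> x \<in> U \<Longrightarrow> conjugate k f (k x) = k (f x)"
  by (simp add: conjugate_at)

text \<open>The pointwise form of \<open>f' k = k f\<close>; all identities between conjugates below are obtained from it.\<close>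

lemma conjugate_unique:
  assumes "k \<in> G" "f \<in> G" "f' \<in> G" "\<And>x. x \<in> U \<Longrightarrow> f' (k x) = k (f x)"
  shows "f' = conjugate k f"
proof (rule G_ext)
  fix x assume "x \<in> U"
  then show "f' x = conjugate k f x"
    using assms(4)[of "inverse_perm k x"] assms by (simp add: conjugate_at)
qed (use assms in \<open>auto intro: G_conjugate\<close>)

lemma conjugate_compose:
  assumes "k \<in> G" "l \<in> G" "f \<in> G"
  shows "conjugate k (conjugate l f) = conjugate (compose U k l) f"
  by (rule conjugate_unique) (use assms in \<open>auto intro!: G_conjugate G_compose simp: conjugate_apply[OF _ G_conjugate] conjugate_apply\<close>)

lemma conjugate_inverse [simp]:
  assumes "k \<in> G" "f \<in> G"
  shows "conjugate (inverse_perm k) (conjugate k f) = f"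
    and "conjugate k (conjugate (inverse_perm k) f) = f"
proof -
  show "conjugate (inverse_perm k) (conjugate k f) = f"
    by (rule conjugate_unique[symmetric])
      (use assms in \<open>auto intro!: G_conjugate G_inverse simp: conjugate_at\<close>)
  have "k (conjugate (inverse_perm k) f x) = f (k x)" if "x \<in> U" for x
  proof -
    have "conjugate (inverse_perm k) f (inverse_perm k (k x)) = inverse_perm k (f (k x))"
      using assms that by (intro conjugate_apply) (auto simp: G_inverse)
    then show ?thesis using assms that by simp
  qed
  then show "conjugate k (conjugate (inverse_perm k) f) = f"
    by (intro conjugate_unique[symmetric]) (use assms in \<open>auto intro!: G_conjugate G_inverse\<close>)
qed

lemma stab_sub: "k \<in> stab A \<Longrightarrow> k \<in> G"
  by (simp add: stab_def)

lemma stab_inverse: "A \<subseteq> U \<Longrightarrow> k \<in> stab A \<Longrightarrow> inverse_perm k \<in> stab A"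
  unfolding stab_def by (auto simp: G_inverse) (metis inverse_left subsetD)

lemma basicI: "h \<in> G \<Longrightarrow> finite T \<Longrightarrow> T \<subseteq> U \<Longrightarrow> nbhd h T \<in> basic"
  by (auto simp: basic_def)

lemma self_nbhd: "h \<in> G \<Longrightarrow> h \<in> nbhd h T"
  by (simp add: nbhd_def)

lemma nbhd_recenter: "g \<in> nbhd h T \<Longrightarrow> nbhd h T = nbhd g T"
  by (auto simp: nbhd_def)

lemma basic_sub: "V \<in> basic \<Longrightarrow> V \<subseteq> G"
  by (auto simp: basic_def nbhd_def)

lemma basic_nonempty:
  assumes "V \<in> basic" obtains f where "f \<in> V" "f \<in> G"
  using assms self_nbhd by (auto simp: basic_def)

lemma basic_centered:
  assumes "V \<in> basic" "g \<in> V"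
  obtains T where "finite T" "T \<subseteq> U" "V = nbhd g T"
  using assms nbhd_recenter unfolding basic_def by blast

lemma G_basic: "G \<in> basic"
proof -
  have "G = nbhd (\<lambda>x\<in>U. x) {}" by (simp add: nbhd_def)
  then show ?thesis using basicI[OF G_id, of "{}"] by simp
qed

lemma basic_Int:
  assumes "V \<in> basic" "W \<in> basic" "g \<in> V" "g \<in> W"
  shows "V \<inter> W \<in> basic"
proof -
  obtain S where S: "finite S" "S \<subseteq> U" "V = nbhd g S" using assms basic_centered by metis
  obtain T where T: "finite T" "T \<subseteq> U" "W = nbhd g T" using assms basic_centered by metis
  have "V \<inter> W = nbhd g (S \<union> T)" using S T by (auto simp: nbhd_def)
  then show ?thesis using S T assms(3) basic_sub[OF assms(1)] by (auto intro: basicI)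
qed

lemma basic_complement:
  assumes "V \<in> basic" "g \<in> G" "g \<notin> V"
  obtains W where "W \<in> basic" "g \<in> W" "W \<inter> V = {}"
proof -
  obtain h T where V: "h \<in> G" "finite T" "T \<subseteq> U" "V = nbhd h T" using assms by (auto simp: basic_def)
  have "nbhd g T \<inter> V = {}" using V assms by (auto simp: nbhd_def)
  then show ?thesis using that[of "nbhd g T"] V assms by (auto intro: basicI self_nbhd)
qed

lemma conjugate_basic:
  assumes "k \<in> G" "V \<in> basic"
  shows "conjugate k ` V \<in> basic"
proof -
  obtain h T where V: "h \<in> G" "finite T" "T \<subseteq> U" "V = nbhd h T" using assms by (auto simp: basic_def)
  have "conjugate k ` V = nbhd (conjugate k h) (k ` T)"
  proof
    show "conjugate k ` V \<subseteq> nbhd (conjugate k h) (k ` T)"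
      using V assms by (auto simp: nbhd_def conjugate_apply G_conjugate subset_iff)
  next
    show "nbhd (conjugate k h) (k ` T) \<subseteq> conjugate k ` V"
    proof
      fix g assume g: "g \<in> nbhd (conjugate k h) (k ` T)"
      then have gG: "g \<in> G" by (simp add: nbhd_def)
      have "conjugate (inverse_perm k) g x = h x" if "x \<in> T" for x
      proof -
        have x: "x \<in> U" using that V by auto
        have "g (k x) = k (h x)" using g that x V assms by (auto simp: nbhd_def conjugate_apply)
        moreover have "inverse_perm k (k x) = x" using x assms by simp
        ultimately show ?thesis
          using conjugate_apply[of "inverse_perm k" g "k x"] x V assms gG by (simp add: G_inverse)
      qed
      then have "conjugate (inverse_perm k) g \<in> V"
        using V gG assms by (simp add: nbhd_def G_conjugate G_inverse)
      then show "g \<in> conjugate k ` V"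
        using conjugate_inverse(2)[OF assms(1) gG] by (metis imageI)
    qed
  qed
  then show ?thesis using V assms by (auto intro!: basicI G_conjugate)
qed

text \<open>A basic open set depends only on a finite piece of the graph of its centre.\<close>

lemma countable_basic: "countable basic"
proof -
  have "basic \<subseteq> (\<lambda>P. {g \<in> G. \<forall>(x, y)\<in>P. g x = y}) ` {P. P \<subseteq> U \<times> U \<and> finite P}"
  proof
    fix V assume "V \<in> basic"
    then obtain h T where V: "h \<in> G" "finite T" "T \<subseteq> U" "V = nbhd h T" by (auto simp: basic_def)
    have "V = {g \<in> G. \<forall>(x, y)\<in>(\<lambda>x. (x, h x)) ` T. g x = y}" using V by (auto simp: nbhd_def)
    then show "V \<in> (\<lambda>P. {g \<in> G. \<forall>(x, y)\<in>P. g x = y}) ` {P. P \<subseteq> U \<times> U \<and> finite P}"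
      by (rule image_eqI) (use V in auto)
  qed
  moreover have "countable {P. P \<subseteq> U \<times> U \<and> finite P}"
    using countable_Collect_finite_subset[of "U \<times> U"] countable_points by (simp add: conj_commute)
  ultimately show ?thesis by (meson countable_image countable_subset)
qed

lemma exhaustion:
  obtains E :: "nat \<Rightarrow> 'a set" where "\<And>n. finite (E n)" "\<And>n. E n \<subseteq> U" "(\<Union>n. E n) = U"
proof -
  let ?E = "\<lambda>n. {x \<in> U. to_nat_on U x \<le> n}"
  have "finite (?E n)" for n
  proof (rule finite_imageD)
    show "finite (to_nat_on U ` ?E n)" by (rule finite_subset[of _ "{..n}"]) auto
    show "inj_on (to_nat_on U) (?E n)"
      using inj_on_to_nat_on[OF countable_points] by (rule inj_on_subset) auto
  qed
  moreover have "(\<Union>n. ?E n) = U" by auto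
  ultimately show ?thesis using that[of ?E] by auto
qed

text \<open>The condition on images makes the inverses stabilize as well. Without it the pointwise
  limit of permutations would be injective but possibly not surjective.\<close>

lemma stabilizing_limit:
  fixes a :: "nat \<Rightarrow> 'a \<Rightarrow> 'a" and T :: "nat \<Rightarrow> 'a set"
  assumes a: "\<And>n. a n \<in> G" and T: "\<And>n. T n \<subseteq> T (Suc n)" "(\<Union>n. T n) = U"
    and agree: "\<And>n x. x \<in> T n \<Longrightarrow> a (Suc n) x = a n x"
    and onto: "\<And>y. y \<in> U \<Longrightarrow> \<exists>n. y \<in> a n ` T n"
  obtains g where "g \<in> G" "\<And>n x. x \<in> T n \<Longrightarrow> g x = a n x"
proof -
  have Tmono: "T m \<subseteq> T n" if "m \<le> n" for m n using T(1) that by (rule lift_Suc_mono_le)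
  have stable: "a n x = a m x" if "m \<le> n" "x \<in> T m" for m n x
    using that(1)
  proof (induction n rule: dec_induct)
    case (step n)
    then show ?case using agree[of x n] Tmono[of m n] that(2) by auto
  qed simp
  define g where "g = (\<lambda>x\<in>U. a (SOME n. x \<in> T n) x)"
  have g: "g x = a n x" if "x \<in> T n" for n x
  proof -
    have "x \<in> T (SOME n. x \<in> T n)" using that by (rule someI)
    then have "a (SOME n. x \<in> T n) x = a n x"
      using stable[of _ n x] stable[of n _ x] that by (metis nat_le_linear)
    moreover have "x \<in> U" using that T(2) by auto
    ultimately show ?thesis by (simp add: g_def)
  qed
  have fin: "\<exists>n. S \<subseteq> T n" if "finite S" "S \<subseteq> U" for S
    using that
  proof (induction S rule: finite_induct)
    case (insert x F)
    then obtain n m where "F \<subseteq> T n" "x \<in> T m" using T(2) by auto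
    then have "insert x F \<subseteq> T (max n m)"
      using Tmono[of n "max n m"] Tmono[of m "max n m"] by auto
    then show ?case by blast
  qed simp
  have "g \<in> Bij U"
  proof -
    have "inj_on g U"
    proof (rule inj_onI)
      fix x y assume xy: "x \<in> U" "y \<in> U" "g x = g y"
      then obtain n where "{x, y} \<subseteq> T n" using fin[of "{x, y}"] by auto
      then show "x = y" using xy g[of x n] g[of y n] G_inj[OF a[of n]] by simp
    qed
    moreover have "g ` U = U"
    proof
      show "g ` U \<subseteq> U"
      proof
        fix y assume "y \<in> g ` U"
        then obtain x n where "x \<in> T n" "x \<in> U" "y = g x" using T(2) by blast
        then show "y \<in> U" using g a by simp
      qed
      show "U \<subseteq> g ` U"
      proof
        fix y assume "y \<in> U"
        then obtain n x where "x \<in> T n" "y = a n x" using onto by blast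
        then have "g x = y" "x \<in> U" using g[of x n] T(2) by auto
        then show "y \<in> g ` U" by auto
      qed
    qed
    ultimately show ?thesis by (simp add: Bij_def bij_betw_def g_def)
  qed
  then have "g \<in> G"
  proof (rule pointwise_closed)
    fix S assume "finite S" "S \<subseteq> U"
    then obtain n where "S \<subseteq> T n" using fin by blast
    then have "\<forall>x\<in>S. a n x = g x" using g[of _ n] by auto
    then show "\<exists>h\<in>G. \<forall>x\<in>S. h x = g x" using a by blast
  qed
  then show ?thesis using that g by blast
qed

text \<open>The Baire property, phrased with basic open sets. The proof shrinks basic open sets
  into the successive \<open>D n\<close>; the domain and the image are made to absorb the whole of \<open>U\<close>, so
  that the centres of these sets converge in \<open>G\<close>.\<close>

lemma nonempty_Int_of_dense:
  fixes D :: "nat \<Rightarrow> ('a \<Rightarrow> 'a) set"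
  assumes V: "V \<in> basic"
    and dense: "\<And>n W. W \<in> basic \<Longrightarrow> W \<subseteq> V \<Longrightarrow> \<exists>W'\<in>basic. W' \<subseteq> W \<inter> D n"
  shows "\<exists>f\<in>V. \<forall>n. f \<in> D n"
proof -
  obtain E :: "nat \<Rightarrow> 'a set" where E: "\<And>n. finite (E n)" "\<And>n. E n \<subseteq> U" "(\<Union>n. E n) = U"
    using exhaustion by blast
  define P where "P = (\<lambda>(n::nat) (h, T). h \<in> V \<and> finite T \<and> T \<subseteq> U \<and> nbhd h T \<subseteq> V)"
  define Q where "Q = (\<lambda>n (h, T) (h', T'). T \<subseteq> T' \<and> h' \<in> nbhd h T \<and> E n \<subseteq> T' \<and>
    E n \<subseteq> h' ` T' \<and> nbhd h' T' \<subseteq> D n)"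
  have "\<exists>s. P 0 s"
  proof -
    obtain h where h: "h \<in> V" using V basic_nonempty by blast
    then obtain T where "finite T" "T \<subseteq> U" "V = nbhd h T" using V basic_centered by metis
    with h have "P 0 (h, T)" by (simp add: P_def)
    then show ?thesis ..
  qed
  moreover have "\<exists>s'. P (Suc n) s' \<and> Q n s s'" if "P n s" for s n
  proof -
    obtain h T where s: "s = (h, T)" by force
    have h: "h \<in> V" "h \<in> G" "finite T" "T \<subseteq> U" "nbhd h T \<subseteq> V"
      using that V basic_sub by (auto simp: P_def s)
    obtain W' where W': "W' \<in> basic" "W' \<subseteq> nbhd h T \<inter> D n"
      using dense[of "nbhd h T" n] basicI h by blast
    obtain h' where h': "h' \<in> W'" using W' basic_nonempty by blast
    then obtain S where S: "finite S" "S \<subseteq> U" "W' = nbhd h' S" using W' basic_centered by metis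
    have h'G: "h' \<in> G" using h' W' basic_sub by auto
    define T' where "T' = T \<union> S \<union> E n \<union> inverse_perm h' ` E n"
    have "nbhd h' T' \<subseteq> W'" using S by (auto simp: nbhd_def T'_def)
    moreover have "E n \<subseteq> h' ` T'"
    proof
      fix y assume y: "y \<in> E n"
      then have "y = h' (inverse_perm h' y)" using E(2) h'G by (auto simp: subset_iff)
      then show "y \<in> h' ` T'" using y by (auto simp: T'_def)
    qed
    moreover have "finite T'" "T' \<subseteq> U"
      using S E(1,2) h h'G by (auto simp: T'_def subset_iff)
    ultimately have "P (Suc n) (h', T')" "Q n s (h', T')"
      using h W' h' by (auto simp: P_def Q_def s T'_def)
    then show ?thesis by blast
  qed
  ultimately obtain s where s: "\<And>n. P n (s n)" "\<And>n. Q n (s n) (s (Suc n))"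
    using dependent_nat_choice[of P Q] by metis
  define a where "a = fst \<circ> s"
  define T where "T = snd \<circ> s"
  have P: "a n \<in> V" "finite (T n)" "T n \<subseteq> U" "nbhd (a n) (T n) \<subseteq> V" for n
    using s(1)[of n] by (auto simp: P_def a_def T_def split: prod.splits)
  have Q: "T n \<subseteq> T (Suc n)" "a (Suc n) \<in> nbhd (a n) (T n)" "E n \<subseteq> T (Suc n)"
    "E n \<subseteq> a (Suc n) ` T (Suc n)" "nbhd (a (Suc n)) (T (Suc n)) \<subseteq> D n" for n
    using s(2)[of n] by (auto simp: Q_def a_def T_def split: prod.splits)
  obtain g where g: "g \<in> G" "\<And>n x. x \<in> T n \<Longrightarrow> g x = a n x"
  proof (rule stabilizing_limit[of a T])
    show "a n \<in> G" for n using P basic_sub[OF V] by blast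
    show "(\<Union>n. T n) = U" using P(3) Q(3) E(3) by blast
    show "\<exists>n. y \<in> a n ` T n" if "y \<in> U" for y using that E(3) Q(4) by blast
  qed (use Q in \<open>auto simp: nbhd_def\<close>)
  have gN: "g \<in> nbhd (a n) (T n)" for n using g by (simp add: nbhd_def)
  then have "g \<in> V" "\<forall>n. g \<in> D n" using P(4)[of 0] Q(5) by blast+
  then show ?thesis by blast
qed

section \<open>Generic elements and back-and-forth\<close>

text \<open>The second clause says that \<open>f\<close> has mixing neighbourhoods of every level; the third that the orbit
  of \<open>f\<close> under the stabilizer of \<open>A\<close> is dense in every basic set containing \<open>f\<close> that is mixing
  relative to \<open>A\<close>. With \<open>A = {}\<close> the latter includes density of the conjugacy class whenever \<open>G\<close>
  itself is mixing.\<close>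

definition saturated :: "('a \<Rightarrow> 'a) \<Rightarrow> bool" where
  "saturated f \<longleftrightarrow> f \<in> G \<and>
     (\<forall>A. finite A \<and> A \<subseteq> U \<longrightarrow> (\<exists>V\<in>basic. mixing A V \<and> f \<in> V)) \<and>
     (\<forall>A V W. finite A \<and> A \<subseteq> U \<and> V \<in> basic \<and> W \<in> basic \<and> mixing A V \<and> W \<subseteq> V \<and> f \<in> V \<longrightarrow>
        (\<exists>k\<in>stab A. conjugate k f \<in> W))"

lemma saturated_mixing: "saturated f \<Longrightarrow> finite A \<Longrightarrow> A \<subseteq> U \<Longrightarrow> \<exists>V\<in>basic. mixing A V \<and> f \<in> V"
  by (simp add: saturated_def)

lemma saturated_conjugate_into:
  "saturated f \<Longrightarrow> finite A \<Longrightarrow> A \<subseteq> U \<Longrightarrow> V \<in> basic \<Longrightarrow> W \<in> basic \<Longrightarrow> mixing A V \<Longrightarrow> W \<subseteq> V \<Longrightarrow> f \<in> V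
    \<Longrightarrow> \<exists>k\<in>stab A. conjugate k f \<in> W"
  unfolding saturated_def by blast

lemma mixing_subset: "mixing A V \<Longrightarrow> W \<subseteq> V \<Longrightarrow> mixing A W"
  unfolding mixing_def by (meson subset_trans)

text \<open>The identity \<open>(k l k\<^sup>-\<^sup>1) (k u k\<^sup>-\<^sup>1) (k l k\<^sup>-\<^sup>1)\<^sup>-\<^sup>1 = k (l u l\<^sup>-\<^sup>1) k\<^sup>-\<^sup>1\<close>, which makes all notions here
  invariant under conjugation.\<close>

lemma conjugate_conjugate:
  assumes "k \<in> G" "l \<in> G" "u \<in> G"
  shows "conjugate (conjugate k l) (conjugate k u) = conjugate k (conjugate l u)"
proof -
  have "compose U (conjugate k l) k = compose U k l"
    by (rule G_ext) (use assms in \<open>auto intro!: G_compose G_conjugate simp: conjugate_apply\<close>)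
  then show ?thesis using assms by (simp add: conjugate_compose G_conjugate)
qed

lemma stab_conjugate: "k \<in> G \<Longrightarrow> A \<subseteq> U \<Longrightarrow> l \<in> stab A \<Longrightarrow> conjugate k l \<in> stab (k ` A)"
  by (auto simp: stab_def G_conjugate conjugate_apply subset_iff)

lemma conjugate_image_inverse:
  assumes "k \<in> G" "V \<subseteq> G"
  shows "conjugate k ` conjugate (inverse_perm k) ` V = V"
    and "conjugate (inverse_perm k) ` conjugate k ` V = V"
  using assms by (force simp: image_image subset_iff)+

lemma mixing_conjugate:
  assumes k: "k \<in> G" and A: "A \<subseteq> U" and V: "V \<in> basic" "mixing A V"
  shows "mixing (k ` A) (conjugate k ` V)"
  unfolding mixing_def
proof (intro ballI impI)
  fix W0 W1 assume W: "W0 \<in> basic" "W1 \<in> basic" "W0 \<subseteq> conjugate k ` V \<and> W1 \<subseteq> conjugate k ` V"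
  let ?c = "conjugate (inverse_perm k)"
  have "?c ` W0 \<subseteq> V" "?c ` W1 \<subseteq> V"
    using W conjugate_image_inverse(2)[OF k basic_sub[OF V(1)]] by blast+
  moreover have "?c ` W0 \<in> basic" "?c ` W1 \<in> basic"
    by (rule conjugate_basic[OF G_inverse[OF k] W(1)], rule conjugate_basic[OF G_inverse[OF k] W(2)])
  ultimately obtain l u where l: "l \<in> stab A" and u: "u \<in> ?c ` W0" "conjugate l u \<in> ?c ` W1"
    using V(2)[unfolded mixing_def] by metis
  have uG: "u \<in> G" using u(1) W(1) k basic_sub by (auto intro!: G_conjugate G_inverse)
  have "conjugate k u \<in> W0" "conjugate k (conjugate l u) \<in> W1"
    using u conjugate_image_inverse(1)[OF k basic_sub[OF W(1)]]
      conjugate_image_inverse(1)[OF k basic_sub[OF W(2)]] by blast+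
  then show "\<exists>k'\<in>stab (k ` A). \<exists>u\<in>W0. conjugate k' u \<in> W1"
    using stab_conjugate[OF k A l] conjugate_conjugate[OF k stab_sub[OF l] uG] by metis
qed

lemma saturated_conjugate:
  assumes k: "k \<in> G" and f: "saturated f"
  shows "saturated (conjugate k f)"
proof -
  have fG: "f \<in> G" using f by (simp add: saturated_def)
  let ?c = "conjugate (inverse_perm k)"
  have img: "k ` inverse_perm k ` A = A" if "A \<subseteq> U" for A
    using that k by (force simp: image_image subset_iff)
  have inv: "inverse_perm k ` A \<subseteq> U" if "A \<subseteq> U" for A
    using that k by auto
  have "\<exists>V\<in>basic. mixing A V \<and> conjugate k f \<in> V" if A: "finite A" "A \<subseteq> U" for A
  proof -
    obtain V where V: "V \<in> basic" "mixing (inverse_perm k ` A) V" "f \<in> V"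
      using saturated_mixing[OF f finite_imageI[OF A(1)] inv[OF A(2)]] by blast
    then show ?thesis
      using mixing_conjugate[OF k inv[OF A(2)] V(1,2)] conjugate_basic[OF k V(1)] img[OF A(2)] by auto
  qed
  moreover have "\<exists>l\<in>stab A. conjugate l (conjugate k f) \<in> W"
    if A: "finite A" "A \<subseteq> U" and V: "V \<in> basic" "W \<in> basic" "mixing A V" "W \<subseteq> V"
      and fV: "conjugate k f \<in> V" for A V W
  proof -
    have 1: "mixing (inverse_perm k ` A) (?c ` V)"
      using mixing_conjugate[OF G_inverse[OF k] A(2) V(1,3)] .
    have 2: "f \<in> ?c ` V" using fV conjugate_inverse(1)[OF k fG] by (metis imageI)
    have 3: "?c ` W \<in> basic" "?c ` V \<in> basic" "?c ` W \<subseteq> ?c ` V"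
      using conjugate_basic[OF G_inverse[OF k] V(2)] conjugate_basic[OF G_inverse[OF k] V(1)]
        image_mono[OF V(4)] by simp_all
    obtain l where l: "l \<in> stab (inverse_perm k ` A)" "conjugate l f \<in> ?c ` W"
      using saturated_conjugate_into[OF f finite_imageI[OF A(1)] inv[OF A(2)] 3(2,1) 1 3(3) 2] by blast
    have "conjugate k (conjugate l f) \<in> W"
      using l conjugate_image_inverse(1)[OF k basic_sub[OF V(2)]] by blast
    moreover have "conjugate k l \<in> stab A"
      using stab_conjugate[OF k inv[OF A(2)] l(1)] img[OF A(2)] by simp
    ultimately show ?thesis
      using conjugate_conjugate[OF k stab_sub[OF l(1)] fG] by metis
  qed
  ultimately show ?thesis using G_conjugate[OF k fG] unfolding saturated_def by blast
qed

text \<open>One half-step of the back-and-forth. The element \<open>u\<close> picks a smaller mixing set relative to the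
  larger \<open>B\<close>, and \<open>w\<close> follows it there, conjugated by an element that fixes \<open>A\<close>
  and so preserves everything achieved on \<open>A\<close>.\<close>

lemma saturated_step:
  assumes u: "saturated u" and w: "saturated w" and A: "finite A" "A \<subseteq> U"
    and V: "V \<in> basic" "mixing A V" "u \<in> V" "w \<in> V"
    and B: "finite B" "B \<subseteq> U" "A \<subseteq> B"
  shows "\<exists>k\<in>stab A. \<exists>V'\<in>basic. V' \<subseteq> V \<and> mixing B V' \<and> u \<in> V' \<and>
    conjugate k w \<in> V' \<and> V' \<subseteq> nbhd u B"
proof -
  obtain V0 where V0: "V0 \<in> basic" "mixing B V0" "u \<in> V0"
    using saturated_mixing[OF u B(1,2)] by blast
  have uG: "u \<in> G" using u by (simp add: saturated_def)
  define V' where "V' = (V \<inter> V0) \<inter> nbhd u B"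
  have uV': "u \<in> V'" using V V0 self_nbhd[OF uG] by (simp add: V'_def)
  have "V \<inter> V0 \<in> basic" using V V0 by (intro basic_Int[of V V0 u]) auto
  then have V': "V' \<in> basic"
    unfolding V'_def using V V0 uG B self_nbhd[OF uG] by (intro basic_Int[of _ _ u] basicI) auto
  have "V' \<subseteq> V" by (auto simp: V'_def)
  then obtain k where "k \<in> stab A" "conjugate k w \<in> V'"
    using saturated_conjugate_into[OF w A V(1) V' V(2) _ V(4)] by blast
  moreover have "mixing B V'" using V0(2) by (rule mixing_subset) (auto simp: V'_def)
  moreover have "V' \<subseteq> V" "V' \<subseteq> nbhd u B" by (auto simp: V'_def)
  ultimately show ?thesis using V' uV' by blast
qed

text \<open>Two sequences of conjugators \<open>a n\<close>, \<open>b n\<close> are built such that the conjugates of \<open>f\<close> by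
  \<open>a n\<close> and of \<open>f'\<close> by \<open>b n\<close> lie in a common mixing set and agree on a finite set \<open>A n\<close>. Later conjugators
  are obtained from earlier ones by left multiplication with elements fixing \<open>A n\<close>. As \<open>A n\<close> grows
  it absorbs the points of \<open>U\<close> and their images under \<open>a n\<close> and \<open>b n\<close>, so both sequences stabilize,
  and the limits conjugate \<open>f\<close> and \<open>f'\<close> to the same element.\<close>

lemma saturated_conjugate_to_each_other:
  assumes trans: "mixing {} G" and f: "saturated f" and f': "saturated f'"
  shows "\<exists>k\<in>G. f' = conjugate k f"
proof -
  have fG: "f \<in> G" "f' \<in> G" using f f' by (auto simp: saturated_def)
  obtain E :: "nat \<Rightarrow> 'a set" where E: "\<And>n. finite (E n)" "\<And>n. E n \<subseteq> U" "(\<Union>n. E n) = U"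
    using exhaustion by blast
  define P where "P = (\<lambda>(n::nat) (a, b, A, V). a \<in> G \<and> b \<in> G \<and> finite A \<and> A \<subseteq> U \<and> V \<in> basic \<and>
    mixing A V \<and> conjugate a f \<in> V \<and> conjugate b f' \<in> V \<and>
    (\<forall>y\<in>A. conjugate a f y = conjugate b f' y))"
  define Q where "Q = (\<lambda>n (a, b, A, V :: ('a \<Rightarrow> 'a) set) (a', b', A', V' :: ('a \<Rightarrow> 'a) set).
    A \<subseteq> A' \<and> E n \<subseteq> A' \<and> a' ` E n \<subseteq> A' \<and> b' ` E n \<subseteq> A' \<and>
    (\<forall>x\<in>U. a x \<in> A \<longrightarrow> a' x = a x) \<and> (\<forall>x\<in>U. b x \<in> A \<longrightarrow> b' x = b x))"
  have "P 0 (\<lambda>x\<in>U. x, \<lambda>x\<in>U. x, {}, G)"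
    using trans fG G_basic by (simp add: P_def G_id G_conjugate)
  moreover have "\<exists>s'. P (Suc n) s' \<and> Q n s s'" if "P n s" for s n
  proof -
    obtain a b A V where s: "s = (a, b, A, V)" by (cases s) auto
    have p: "a \<in> G" "b \<in> G" "finite A" "A \<subseteq> U" "V \<in> basic" "mixing A V"
      "conjugate a f \<in> V" "conjugate b f' \<in> V" using that by (auto simp: P_def s)
    \<comment> \<open>First half-step: \<open>b\<close> moves, with \<open>a\<close> kept. The set \<open>A1\<close> absorbs the images under \<open>a\<close> of the points
      handled now, so that the second half-step, which fixes \<open>A1\<close>, does not change them.\<close>
    define A1 where "A1 = A \<union> E n \<union> a ` E n"
    have A1: "finite A1" "A1 \<subseteq> U" "A \<subseteq> A1" using p E(1,2)[of n] by (auto simp: A1_def subset_iff)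
    obtain l V1 where l: "l \<in> stab A" "V1 \<in> basic" "V1 \<subseteq> V" "mixing A1 V1" "conjugate a f \<in> V1"
      "conjugate l (conjugate b f') \<in> V1"
      using saturated_step[OF saturated_conjugate[OF p(1) f] saturated_conjugate[OF p(2) f'] p(3-8) A1]
      by blast
    define b' where "b' = compose U l b"
    have b': "b' \<in> G" using l p stab_sub by (auto simp: b'_def intro: G_compose)
    have cb': "conjugate b' f' \<in> V1"
      using l(6) conjugate_compose[OF stab_sub[OF l(1)] p(2) fG(2)] by (simp add: b'_def)
    \<comment> \<open>Second half-step: \<open>a\<close> moves. The images under the new \<open>b'\<close> can be absorbed only now, because \<open>b'\<close>
      was chosen after \<open>A1\<close>.\<close>
    define A2 where "A2 = A1 \<union> b' ` E n"
    have A2: "finite A2" "A2 \<subseteq> U" "A1 \<subseteq> A2" using A1 E(1,2)[of n] b' by (auto simp: A2_def subset_iff)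
    obtain k V2 where k: "k \<in> stab A1" "V2 \<in> basic" "V2 \<subseteq> V1" "mixing A2 V2" "conjugate b' f' \<in> V2"
      "conjugate k (conjugate a f) \<in> V2" "V2 \<subseteq> nbhd (conjugate b' f') A2"
      using saturated_step[OF saturated_conjugate[OF b' f'] saturated_conjugate[OF p(1) f] A1(1,2) l(2,4) cb' l(5) A2]
      by blast
    define a' where "a' = compose U k a"
    have a': "a' \<in> G" using k p stab_sub by (auto simp: a'_def intro: G_compose)
    have ca': "conjugate a' f \<in> V2"
      using k(6) conjugate_compose[OF stab_sub[OF k(1)] p(1) fG(1)] by (simp add: a'_def)
    have "\<forall>y\<in>A2. conjugate a' f y = conjugate b' f' y"
      using ca' k(7) by (auto simp: nbhd_def)
    then have "P (Suc n) (a', b', A2, V2)" using a' b' A2 k ca' by (simp add: P_def)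
    moreover have "a' x = a x" if "x \<in> U" "a x \<in> A1" for x
      using that k(1) by (simp add: a'_def stab_def)
    then have "Q n s (a', b', A2, V2)"
      using A2 A1 l(1) E(2)[of n] by (auto simp: Q_def s b'_def stab_def A2_def A1_def)
    ultimately show ?thesis by blast
  qed
  ultimately obtain s where s: "\<And>n. P n (s n)" "\<And>n. Q n (s n) (s (Suc n))"
    using dependent_nat_choice[of P Q] by metis
  define a where "a n = fst (s n)" for n
  define b where "b n = fst (snd (s n))" for n
  define A where "A n = fst (snd (snd (s n)))" for n
  have P: "a n \<in> G" "b n \<in> G" "A n \<subseteq> U" "\<And>y. y \<in> A n \<Longrightarrow> conjugate (a n) f y = conjugate (b n) f' y" for n
    using s(1)[of n] by (auto simp: P_def a_def b_def A_def split: prod.splits)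
  have Q: "A n \<subseteq> A (Suc n)" "E n \<subseteq> A (Suc n)" "a (Suc n) ` E n \<subseteq> A (Suc n)" "b (Suc n) ` E n \<subseteq> A (Suc n)"
    "\<And>x. x \<in> U \<Longrightarrow> a n x \<in> A n \<Longrightarrow> a (Suc n) x = a n x"
    "\<And>x. x \<in> U \<Longrightarrow> b n x \<in> A n \<Longrightarrow> b (Suc n) x = b n x" for n
    using s(2)[of n] by (auto simp: Q_def a_def b_def A_def split: prod.splits)
  have Amono: "A m \<subseteq> A n" if "m \<le> n" for m n using Q(1) that by (rule lift_Suc_mono_le)
  \<comment> \<open>The sequence \<open>c\<close> stands for \<open>a\<close> or \<open>b\<close>.\<close>
  have limit: "\<exists>g\<in>G. \<forall>x\<in>U. \<exists>N. \<forall>n\<ge>N. g x = c n x \<and> c n x \<in> A n"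
    if c: "\<And>n. c n \<in> G" "\<And>n. c (Suc n) ` E n \<subseteq> A (Suc n)"
      "\<And>n x. x \<in> U \<Longrightarrow> c n x \<in> A n \<Longrightarrow> c (Suc n) x = c n x" for c
  proof -
    define T where "T n = {x \<in> U. c n x \<in> A n}" for n
    have T: "T n \<subseteq> T (Suc n)" for n using c(3) Q(1)[of n] by (auto simp: T_def subset_iff)
    have Tmono: "T m \<subseteq> T n" if "m \<le> n" for m n using T that by (rule lift_Suc_mono_le)
    have ET: "E n \<subseteq> T (Suc n)" for n using c(2) E(2) by (auto simp: T_def)
    have cov: "(\<Union>n. T n) = U"
    proof
      show "(\<Union>n. T n) \<subseteq> U" by (auto simp: T_def)
      show "U \<subseteq> (\<Union>n. T n)" using E(3) ET by blast
    qed
    obtain g where g: "g \<in> G" "\<And>n x. x \<in> T n \<Longrightarrow> g x = c n x"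
    proof (rule stabilizing_limit[of c T])
      fix y assume y: "y \<in> U"
      then obtain n where "y \<in> A (Suc n)" using E(3) Q(2) by blast
      then have "inverse_perm (c (Suc n)) y \<in> T (Suc n)" "y = c (Suc n) (inverse_perm (c (Suc n)) y)"
        using y c(1) by (auto simp: T_def)
      then show "\<exists>n. y \<in> c n ` T n" by blast
    qed (use c T cov in \<open>auto simp: T_def\<close>)
    have "\<exists>N. \<forall>n\<ge>N. g x = c n x \<and> c n x \<in> A n" if x: "x \<in> U" for x
    proof -
      obtain N where "x \<in> T N" using cov x by blast
      then have "\<forall>n\<ge>N. x \<in> T n" using Tmono by blast
      then show ?thesis using g(2) by (auto simp: T_def)
    qed
    then show ?thesis using g(1) by blast
  qed
  obtain g where g: "g \<in> G" "\<And>x. x \<in> U \<Longrightarrow> \<exists>N. \<forall>n\<ge>N. g x = a n x \<and> a n x \<in> A n"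
    using limit[OF P(1) Q(3) Q(5)] by blast
  obtain h where h: "h \<in> G" "\<And>x. x \<in> U \<Longrightarrow> \<exists>N. \<forall>n\<ge>N. h x = b n x \<and> b n x \<in> A n"
    using limit[OF P(2) Q(4) Q(6)] by blast
  have conv: "\<exists>N. \<forall>n\<ge>N. conjugate g' v y = conjugate (c n) v y"
    if c: "\<And>n. c n \<in> G" "g' \<in> G" "v \<in> G" "y \<in> U"
      and lim: "\<And>x. x \<in> U \<Longrightarrow> \<exists>N. \<forall>n\<ge>N. g' x = c n x \<and> c n x \<in> A n" for g' c v y
  proof -
    let ?x = "inverse_perm g' y"
    have x: "?x \<in> U" "v ?x \<in> U" using c by auto
    obtain N1 where N1: "\<forall>n\<ge>N1. g' ?x = c n ?x" using lim[OF x(1)] by blast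
    obtain N2 where N2: "\<forall>n\<ge>N2. g' (v ?x) = c n (v ?x)" using lim[OF x(2)] by blast
    have "conjugate g' v y = conjugate (c n) v y" if "n \<ge> max N1 N2" for n
    proof -
      have "y = c n ?x" using N1 that c by auto
      then have "conjugate (c n) v y = c n (v ?x)" using conjugate_apply[OF c(1)[of n] c(3) x(1)] by simp
      also have "\<dots> = g' (v ?x)" using N2[rule_format, of n] that by simp
      finally show ?thesis using c by (simp add: conjugate_at)
    qed
    then show ?thesis by blast
  qed
  have eq: "conjugate h f' = conjugate g f"
  proof (rule G_ext)
    fix y assume y: "y \<in> U"
    obtain N1 where N1: "\<forall>n\<ge>N1. conjugate g f y = conjugate (a n) f y"
      using conv[OF P(1) g(1) fG(1) y g(2)] by blast
    obtain N2 where N2: "\<forall>n\<ge>N2. conjugate h f' y = conjugate (b n) f' y"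
      using conv[OF P(2) h(1) fG(2) y h(2)] by blast
    obtain m where m: "y \<in> A (Suc m)" using y E(3) Q(2) by blast
    define n where "n = max (Suc m) (max N1 N2)"
    have "y \<in> A n" using m Amono[of "Suc m" n] by (auto simp: n_def)
    then show "conjugate h f' y = conjugate g f y" 
      using P(4)[of y n] N1[rule_format, of n] N2[rule_format, of n] by (simp add: n_def)
  qed (use g h fG in \<open>auto intro: G_conjugate\<close>)
  have "f' = conjugate (inverse_perm h) (conjugate g f)"
    using conjugate_inverse(1)[OF h(1) fG(2)] eq by simp
  then have "f' = conjugate (compose U (inverse_perm h) g) f"
    using conjugate_compose G_inverse g h fG by simp
  then show ?thesis using G_compose G_inverse g h by blast
qed

section \<open>Dense Gdelta conjugacy classes\<close>

abbreviation perm_topology :: "('a \<Rightarrow> 'a) topology" where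
  "perm_topology \<equiv> subtopology (product_topology (\<lambda>_. discrete_topology U) U) G"

lemma topspace_perm [simp]: "topspace perm_topology = G"
proof -
  have "G \<subseteq> (\<Pi>\<^sub>E i\<in>U. U)"
    using Bij_imp_extensional[OF G_Bij] Bij_imp_funcset[OF G_Bij] by (auto simp: PiE_def)
  then show ?thesis by auto
qed

lemma openin_basic:
  assumes "V \<in> basic" shows "openin perm_topology V"
proof -
  obtain h T where V: "h \<in> G" "finite T" "T \<subseteq> U" "V = nbhd h T" using assms by (auto simp: basic_def)
  let ?P = "\<Pi>\<^sub>E i\<in>U. (if i \<in> T then {h i} else U)"
  have "finite {i \<in> U. (if i \<in> T then {h i} else U) \<noteq> U}"
    by (rule finite_subset[OF _ V(2)]) auto
  then have "openin (product_topology (\<lambda>_. discrete_topology U) U) ?P"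
    unfolding openin_PiE_gen using V(1) by simp
  moreover have "g \<in> V \<longleftrightarrow> g \<in> ?P" if "g \<in> G" for g
  proof -
    have "g \<in> extensional U" using Bij_imp_extensional[OF G_Bij[OF that]] .
    then have "g \<in> ?P \<longleftrightarrow> (\<forall>i\<in>T. g i = h i)"
      using that V(3) by (auto simp: PiE_iff subset_iff)
    then show ?thesis using V(4) that by (simp add: nbhd_def)
  qed
  then have "V = ?P \<inter> G" using basic_sub[OF assms] by blast
  ultimately show ?thesis unfolding openin_subtopology by blast
qed

text \<open>Identifies the subspace topology of the product of discrete spaces with the topology generated by
  the basic sets; from here on only the latter is used.\<close>

lemma openin_perm_iff:
  "openin perm_topology D \<longleftrightarrow> D \<subseteq> G \<and> (\<forall>g\<in>D. \<exists>W\<in>basic. g \<in> W \<and> W \<subseteq> D)"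
proof
  assume op: "openin perm_topology D"
  then obtain O' where O': "openin (product_topology (\<lambda>_. discrete_topology U) U) O'" "D = O' \<inter> G"
    unfolding openin_subtopology by blast
  have "\<exists>W\<in>basic. g \<in> W \<and> W \<subseteq> D" if "g \<in> D" for g
  proof -
    have g: "g \<in> G" "g \<in> O'" using that O' by auto
    then obtain Y where Y: "finite {i \<in> U. Y i \<noteq> U}" "g \<in> Pi\<^sub>E U Y" "Pi\<^sub>E U Y \<subseteq> O'"
      using O'(1) unfolding openin_product_topology_alt by auto
    have "nbhd g {i \<in> U. Y i \<noteq> U} \<subseteq> Pi\<^sub>E U Y"
    proof
      fix h assume h: "h \<in> nbhd g {i \<in> U. Y i \<noteq> U}"
      then have hG: "h \<in> G" by (simp add: nbhd_def)
      have "h i \<in> Y i" if "i \<in> U" for i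
      proof (cases "Y i = U")
        case True
        then show ?thesis using hG that by simp
      next
        case False
        then have "h i = g i" using h that by (simp add: nbhd_def)
        then show ?thesis using Y(2) that by (auto simp: PiE_iff)
      qed
      then show "h \<in> Pi\<^sub>E U Y" using Bij_imp_extensional[OF G_Bij[OF hG]] by (auto simp: PiE_def)
    qed
    then have "nbhd g {i \<in> U. Y i \<noteq> U} \<subseteq> D" using Y(3) O'(2) by (auto simp: nbhd_def)
    then show ?thesis
      using Y(1) g(1) self_nbhd by (intro bexI[of _ "nbhd g {i \<in> U. Y i \<noteq> U}"]) (auto intro: basicI)
  qed
  moreover have "D \<subseteq> G" using O' by auto
  ultimately show "D \<subseteq> G \<and> (\<forall>g\<in>D. \<exists>W\<in>basic. g \<in> W \<and> W \<subseteq> D)" by blast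
next
  assume "D \<subseteq> G \<and> (\<forall>g\<in>D. \<exists>W\<in>basic. g \<in> W \<and> W \<subseteq> D)"
  then show "openin perm_topology D" using openin_basic by (subst openin_subopen) blast
qed

lemma dense_iff: "perm_topology closure_of C = topspace perm_topology \<longleftrightarrow> (\<forall>W\<in>basic. W \<inter> C \<noteq> {})"
proof
  assume L: "perm_topology closure_of C = topspace perm_topology"
  show "\<forall>W\<in>basic. W \<inter> C \<noteq> {}"
  proof
    fix W assume W: "W \<in> basic"
    then obtain f where "f \<in> W" "f \<in> G" using basic_nonempty by blast
    from this(2) have "f \<in> perm_topology closure_of C"
      unfolding L topspace_perm .
    then show "W \<inter> C \<noteq> {}" using openin_basic[OF W] \<open>f \<in> W\<close> unfolding in_closure_of by blast
  qed
next
  assume R: "\<forall>W\<in>basic. W \<inter> C \<noteq> {}"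
  have "x \<in> perm_topology closure_of C" if "x \<in> G" for x
    unfolding in_closure_of using that R openin_perm_iff by (metis disjoint_iff subsetD topspace_perm)
  then show "perm_topology closure_of C = topspace perm_topology"
    using closure_of_subset_topspace[of perm_topology C] by auto
qed

abbreviation perm_group :: "('a \<Rightarrow> 'a) monoid" where
  "perm_group \<equiv> BijGroup U\<lparr>carrier := G\<rparr>"

lemma conjugacy_class_eq:
  assumes "f \<in> G"
  shows "conjugacy_class perm_group f = {conjugate k f | k. k \<in> G}"
proof -
  have "k \<otimes>\<^bsub>perm_group\<^esub> f \<otimes>\<^bsub>perm_group\<^esub> inv\<^bsub>perm_group\<^esub> k = conjugate k f" if k: "k \<in> G" for k
  proof -
    have "inv\<^bsub>perm_group\<^esub> k = inverse_perm k"
      using group.m_inv_consistent[OF group_BijGroup subgroup_BijGroup k] inv_BijGroup[OF G_Bij[OF k]]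
      by (simp add: inverse_perm_def)
    then have "k \<otimes>\<^bsub>perm_group\<^esub> f \<otimes>\<^bsub>perm_group\<^esub> inv\<^bsub>perm_group\<^esub> k
        = compose U (compose U k f) (inverse_perm k)"
      using k assms by (simp add: BijGroup_def G_Bij G_compose G_inverse)
    also have "\<dots> = conjugate k f"
      by (rule G_ext) (use k assms in \<open>auto intro!: G_compose G_inverse G_conjugate simp: conjugate_at\<close>)
    finally show ?thesis .
  qed
  then show ?thesis unfolding conjugacy_class_def by force
qed

text \<open>The second claim is a Baire argument. The conjugacy class is a countable union of orbits under the
  stabilizer of \<open>A\<close>, so one of these orbits is dense in some basic \<open>W\<close> inside \<open>V\<close>. Any two
  basic subsets of \<open>W\<close> meet this orbit, hence are connected by an element of the stabilizer.\<close>

lemma dense_Gdelta_class_imp_mixing: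
  assumes f: "f \<in> G" and C: "C = {conjugate k f | k. k \<in> G}"
    and dense: "\<And>W. W \<in> basic \<Longrightarrow> W \<inter> C \<noteq> {}"
    and gd: "gdelta_in perm_topology C"
  shows "mixing {} G"
    and "finite A \<Longrightarrow> A \<subseteq> U \<Longrightarrow> V \<in> basic \<Longrightarrow> \<exists>W\<in>basic. W \<subseteq> V \<and> mixing A W"
proof -
  have link: "\<exists>k\<in>G. conjugate k u = w \<and> k = compose U l' (inverse_perm l)"
    if "u = conjugate l c" "w = conjugate l' c" "l \<in> G" "l' \<in> G" "c \<in> G" for u w l l' c
    using that by (auto intro!: G_compose G_inverse simp: conjugate_compose[symmetric] G_inverse G_conjugate)
  show "mixing {} G"
    unfolding mixing_def
  proof (intro ballI impI)
    fix W0 W1 assume W: "W0 \<in> basic" "W1 \<in> basic"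
    obtain l where l: "l \<in> G" "conjugate l f \<in> W0" using dense[OF W(1)] C by blast
    obtain l' where l': "l' \<in> G" "conjugate l' f \<in> W1" using dense[OF W(2)] C by blast
    show "\<exists>k\<in>stab {}. \<exists>u\<in>W0. conjugate k u \<in> W1"
    proof -
      obtain k where "k \<in> G" "conjugate k (conjugate l f) = conjugate l' f"
        using link[OF refl refl l(1) l'(1) f] by blast
      then have "k \<in> stab {}" "conjugate k (conjugate l f) \<in> W1" using l' by (simp_all add: stab_def)
      then show ?thesis using l(2) by blast
    qed
  qed
  assume A: "finite A" "A \<subseteq> U" and V: "V \<in> basic"
  \<comment> \<open>The members of \<open>Z\<close> are the left cosets of the pointwise stabilizer of \<open>A\<close>, and \<open>P z\<close> is the orbit of a conjugate
    of \<open>f\<close> under this stabilizer: for \<open>z'\<close>, \<open>z''\<close> in one coset, the product of the inverse of \<open>z''\<close>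
    with \<open>z'\<close> fixes \<open>A\<close>. Passing to inverses turns left cosets into right cosets.\<close>
  define Z where "Z = {nbhd z A | z. z \<in> G}"
  define P where "P z = {conjugate (inverse_perm z') f | z'. z' \<in> z}" for z
  have "countable Z"
  proof (rule countable_subset[OF _ countable_basic])
    show "Z \<subseteq> basic" using A by (auto simp: Z_def intro: basicI)
  qed
  have CP: "C \<subseteq> (\<Union>z\<in>Z. P z)"
  proof
    fix g assume "g \<in> C"
    then obtain k where k: "k \<in> G" "g = conjugate k f" using C by blast
    have "g = conjugate (inverse_perm (inverse_perm k)) f" using k by simp
    then have "g \<in> P (nbhd (inverse_perm k) A)"
      using self_nbhd[OF G_inverse[OF k(1)], of A] unfolding P_def by blast
    then show "g \<in> (\<Union>z\<in>Z. P z)" using k(1) G_inverse unfolding Z_def by blast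
  qed
  have "\<exists>z\<in>Z. \<exists>W\<in>basic. W \<subseteq> V \<and> (\<forall>W'\<in>basic. W' \<subseteq> W \<longrightarrow> W' \<inter> P z \<noteq> {})"
  proof (rule ccontr)
    assume "\<not> ?thesis"
    then have no: "\<exists>W'\<in>basic. W' \<subseteq> W \<and> W' \<inter> P z = {}" if "z \<in> Z" "W \<in> basic" "W \<subseteq> V" for z W
      using that by meson
    have "\<exists>\<O>. countable \<O> \<and> \<O> \<subseteq> Collect (openin perm_topology) \<and> \<Inter>\<O> = C"
      using conjunct2[OF gd[unfolded gdelta_in_alt]] unfolding intersection_of_def .
    then obtain \<O> where \<O>: "countable \<O>" "\<And>D. D \<in> \<O> \<Longrightarrow> openin perm_topology D" "C = \<Inter>\<O>"
      by blast
    define \<D> where "\<D> = \<O> \<union> (\<lambda>z. - P z) ` Z"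
    have "countable \<D>" "\<D> \<noteq> {}"
      using \<O>(1) \<open>countable Z\<close> f by (auto simp: \<D>_def Z_def)
    \<comment> \<open>If no orbit were somewhere dense in \<open>V\<close>, some point of \<open>V\<close> would lie in the class but in no orbit.\<close>
    have "\<exists>f'\<in>V. \<forall>n. f' \<in> from_nat_into \<D> n"
    proof (rule nonempty_Int_of_dense[OF V])
      fix n W assume W: "W \<in> basic" "W \<subseteq> V"
      show "\<exists>W'\<in>basic. W' \<subseteq> W \<inter> from_nat_into \<D> n"
      proof (cases "from_nat_into \<D> n \<in> \<O>")
        case True
        obtain g where g: "g \<in> W" "g \<in> C" using dense[OF W(1)] by blast
        then have "g \<in> from_nat_into \<D> n" using True \<O>(3) by blast
        then obtain W1 where "W1 \<in> basic" "g \<in> W1" "W1 \<subseteq> from_nat_into \<D> n"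
          using \<O>(2)[OF True] openin_perm_iff by metis
        then show ?thesis using basic_Int[OF W(1), of W1 g] g(1) by blast
      next
        case False
        then obtain z where z: "z \<in> Z" "from_nat_into \<D> n = - P z"
          using from_nat_into[OF \<open>\<D> \<noteq> {}\<close>, of n] by (auto simp: \<D>_def)
        obtain W' where "W' \<in> basic" "W' \<subseteq> W" "W' \<inter> P z = {}" using no[OF z(1) W] by blast
        then show ?thesis unfolding z(2) by (intro bexI[of _ W']) auto
      qed
    qed
    then obtain f' where f': "\<And>D. D \<in> \<D> \<Longrightarrow> f' \<in> D"
      using from_nat_into_surj[OF \<open>countable \<D>\<close>] by metis
    then have "f' \<in> C" using \<O>(3) by (auto simp: \<D>_def)
    then show False using CP f' by (auto simp: \<D>_def)
  qed
  then obtain z W where zW: "z \<in> Z" "W \<in> basic" "W \<subseteq> V"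
      "\<forall>W'\<in>basic. W' \<subseteq> W \<longrightarrow> W' \<inter> P z \<noteq> {}"
    by (elim bexE conjE)
  obtain z0 where z0: "z0 \<in> G" "z = nbhd z0 A" using zW(1) by (auto simp: Z_def)
  have "mixing A W"
    unfolding mixing_def
  proof (intro ballI impI)
    fix W0 W1 assume W: "W0 \<in> basic" "W1 \<in> basic" "W0 \<subseteq> W \<and> W1 \<subseteq> W"
    obtain l where l: "l \<in> z" "conjugate (inverse_perm l) f \<in> W0"
      using zW(4)[rule_format, OF W(1)] W(3) unfolding P_def by blast
    obtain l' where l': "l' \<in> z" "conjugate (inverse_perm l') f \<in> W1"
      using zW(4)[rule_format, OF W(2)] W(3) unfolding P_def by blast
    have lG: "l \<in> G" "l' \<in> G" using l l' z0 by (auto simp: nbhd_def)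
    define k where "k = compose U (inverse_perm l') (inverse_perm (inverse_perm l))"
    have kG: "k \<in> G" using lG by (auto simp: k_def intro!: G_compose G_inverse)
    have eq: "conjugate k (conjugate (inverse_perm l) f) = conjugate (inverse_perm l') f"
      using link[OF refl refl G_inverse[OF lG(1)] G_inverse[OF lG(2)] f] by (auto simp: k_def)
    have "k x = x" if "x \<in> A" for x
    proof -
      have x: "x \<in> U" using that A by auto
      have "l x = l' x" using that l l' z0 by (simp add: nbhd_def)
      then show ?thesis using x lG by (simp add: k_def)
    qed
    then have "k \<in> stab A" using kG by (simp add: stab_def)
    then show "\<exists>k\<in>stab A. \<exists>u\<in>W0. conjugate k u \<in> W1" using l l' eq by metis
  qed
  then show "\<exists>W\<in>basic. W \<subseteq> V \<and> mixing A W" using zW by blast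
qed

lemma openin_conjugate_into:
  assumes W: "W \<in> basic" and A: "A \<subseteq> U"
  shows "openin perm_topology {f \<in> G. \<exists>k\<in>stab A. conjugate k f \<in> W}"
proof -
  have "\<exists>W'\<in>basic. g \<in> W' \<and> W' \<subseteq> {f \<in> G. \<exists>k\<in>stab A. conjugate k f \<in> W}"
    if g: "g \<in> G" "k \<in> stab A" "conjugate k g \<in> W" for g k
  proof -
    have k: "k \<in> G" using g stab_sub by blast
    let ?W' = "conjugate (inverse_perm k) ` W"
    have "g \<in> ?W'" using g k conjugate_inverse(1)[OF k g(1)] by (metis imageI)
    moreover have "?W' \<in> basic" using conjugate_basic[OF G_inverse[OF k] W] .
    moreover have "conjugate k f \<in> W" if "f \<in> ?W'" for f
      using that conjugate_image_inverse(1)[OF k basic_sub[OF W]] by blast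
    ultimately show ?thesis using g basic_sub by (intro bexI[of _ ?W']) auto
  qed
  then show ?thesis unfolding openin_perm_iff by auto
qed

text \<open>From right to left, the saturated elements form the class. The sets \<open>O1 A\<close> and \<open>O2 (A, V, W)\<close>
  express the two clauses of saturation. They are open, and countably many of them
  suffice because \<open>basic\<close> is countable.\<close>

theorem dense_Gdelta_class_iff:
  "(\<exists>f\<in>G. perm_topology closure_of conjugacy_class perm_group f = topspace perm_topology \<and>
      gdelta_in perm_topology (conjugacy_class perm_group f)) \<longleftrightarrow>
   mixing {} G \<and> (\<forall>A V. finite A \<and> A \<subseteq> U \<and> V \<in> basic \<longrightarrow> (\<exists>W\<in>basic. W \<subseteq> V \<and> mixing A W))"
proof
  assume "\<exists>f\<in>G. perm_topology closure_of conjugacy_class perm_group f = topspace perm_topology \<and>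
      gdelta_in perm_topology (conjugacy_class perm_group f)"
  then obtain f where "f \<in> G" "\<And>W. W \<in> basic \<Longrightarrow> W \<inter> conjugacy_class perm_group f \<noteq> {}"
    "gdelta_in perm_topology (conjugacy_class perm_group f)"
    unfolding dense_iff by blast
  from dense_Gdelta_class_imp_mixing[OF this(1) conjugacy_class_eq[OF this(1)] this(2,3)]
  show "mixing {} G \<and> (\<forall>A V. finite A \<and> A \<subseteq> U \<and> V \<in> basic \<longrightarrow> (\<exists>W\<in>basic. W \<subseteq> V \<and> mixing A W))"
    by blast
next
  assume R: "mixing {} G \<and> (\<forall>A V. finite A \<and> A \<subseteq> U \<and> V \<in> basic \<longrightarrow> (\<exists>W\<in>basic. W \<subseteq> V \<and> mixing A W))"
  define I where "I = {A. finite A \<and> A \<subseteq> U}"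
  define J where "J = {(A, V, W). A \<in> I \<and> V \<in> basic \<and> W \<in> basic \<and> mixing A V \<and> W \<subseteq> V}"
  define O1 where "O1 A = \<Union>{V \<in> basic. mixing A V}" for A
  define O2 where "O2 = (\<lambda>(A, V, W). (G - V) \<union> {f \<in> G. \<exists>k\<in>stab A. conjugate k f \<in> W})"
  define \<D> where "\<D> = O1 ` I \<union> O2 ` J"
  have "countable I"
    using countable_Collect_finite_subset[OF countable_points] by (simp add: I_def)
  moreover have "J \<subseteq> I \<times> basic \<times> basic" by (auto simp: J_def)
  ultimately have cD: "countable \<D>"
    unfolding \<D>_def using countable_basic by (meson countable_SIGMA countable_Un countable_image countable_subset)
  have "{} \<in> I" by (simp add: I_def)
  then have neD: "\<D> \<noteq> {}" by (auto simp: \<D>_def)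
  have op: "openin perm_topology D" if "D \<in> \<D>" for D
    using that unfolding \<D>_def
  proof
    assume "D \<in> O1 ` I"
    then show ?thesis using openin_basic by (auto simp: O1_def intro!: openin_Union)
  next
    assume "D \<in> O2 ` J"
    then obtain A V W where J: "A \<subseteq> U" "V \<in> basic" "W \<in> basic" "D = O2 (A, V, W)"
      by (auto simp: J_def I_def)
    have "openin perm_topology (G - V)"
      unfolding openin_perm_iff
    proof (intro conjI ballI)
      fix g assume "g \<in> G - V"
      then obtain W' where "W' \<in> basic" "g \<in> W'" "W' \<inter> V = {}" using basic_complement[OF J(2)] by blast
      then show "\<exists>W\<in>basic. g \<in> W \<and> W \<subseteq> G - V" using basic_sub by blast
    qed auto
    then show ?thesis using openin_conjugate_into[OF J(3,1)] by (simp add: J(4) O2_def openin_Un)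
  qed
  have sat: "{f. saturated f} = \<Inter>\<D>"
  proof (intro subset_antisym subsetI)
    fix f assume "f \<in> {f. saturated f}"
    then show "f \<in> \<Inter>\<D>"
      by (auto simp: saturated_def \<D>_def O1_def O2_def I_def J_def)
  next
    fix f assume f: "f \<in> \<Inter>\<D>"
    have fG: "f \<in> G" using f op openin_perm_iff neD by blast
    have "\<exists>V\<in>basic. mixing A V \<and> f \<in> V" if "finite A" "A \<subseteq> U" for A
    proof -
      have "f \<in> O1 A" using f that by (auto simp: \<D>_def I_def)
      then show ?thesis by (auto simp: O1_def)
    qed
    moreover have "\<exists>k\<in>stab A. conjugate k f \<in> W"
      if "finite A" "A \<subseteq> U" "V \<in> basic" "W \<in> basic" "mixing A V" "W \<subseteq> V" "f \<in> V" for A V W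
    proof -
      have "(A, V, W) \<in> J" using that by (simp add: J_def I_def)
      then have "f \<in> O2 (A, V, W)" using f by (auto simp: \<D>_def)
      then show ?thesis using that by (auto simp: O2_def)
    qed
    ultimately show "f \<in> {f. saturated f}" using fG unfolding saturated_def by blast
  qed
  \<comment> \<open>Local mixing makes \<open>O1 A\<close> dense. For \<open>O2 (A, V', W)\<close>, a basic set that meets \<open>V'\<close> contains a point of
    \<open>V'\<close> which the stabilizer of \<open>A\<close> moves into \<open>W\<close>, because \<open>V'\<close> is mixing.\<close>
  have meets: "\<exists>W'\<in>basic. W' \<subseteq> V \<inter> D" if V: "V \<in> basic" and D: "D \<in> \<D>" for V D
    using D unfolding \<D>_def
  proof
    assume "D \<in> O1 ` I"
    then obtain A where A: "finite A" "A \<subseteq> U" "D = O1 A" by (auto simp: I_def)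
    then obtain W where "W \<in> basic" "W \<subseteq> V" "mixing A W" using R V by blast
    then show ?thesis using A(3) unfolding O1_def by blast
  next
    assume "D \<in> O2 ` J"
    then obtain A V' W where J: "V' \<in> basic" "W \<in> basic" "mixing A V'" "W \<subseteq> V'" "D = O2 (A, V', W)"
      by (auto simp: J_def I_def)
    have "\<exists>g. g \<in> V \<and> g \<in> D"
    proof (cases "V \<inter> V' = {}")
      case True
      obtain g where "g \<in> V" "g \<in> G" using V basic_nonempty by blast
      then show ?thesis using True by (auto simp: J(5) O2_def)
    next
      case False
      then have "V \<inter> V' \<in> basic" using basic_Int[OF V J(1)] by blast
      then obtain k u where "k \<in> stab A" "u \<in> V \<inter> V'" "conjugate k u \<in> W"
        using J(2,3,4) unfolding mixing_def by blast
      then show ?thesis using basic_sub[OF V] by (auto simp: J(5) O2_def)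
    qed
    then obtain g W1 where "g \<in> V" "W1 \<in> basic" "g \<in> W1" "W1 \<subseteq> D"
      using op[OF D, unfolded openin_perm_iff] by blast
    then show ?thesis using basic_Int[OF V, of W1 g] by blast
  qed
  have sat_dense: "\<exists>f\<in>V. saturated f" if V: "V \<in> basic" for V
  proof -
    have "\<exists>f\<in>V. \<forall>n. f \<in> from_nat_into \<D> n"
      using meets from_nat_into[OF neD] by (intro nonempty_Int_of_dense[OF V]) blast
    then obtain f where f: "f \<in> V" "\<And>D. D \<in> \<D> \<Longrightarrow> f \<in> D" using from_nat_into_surj[OF cD] by metis
    then show ?thesis using sat by blast
  qed
  obtain f where f: "saturated f" using sat_dense[OF G_basic] by blast
  then have fG: "f \<in> G" by (simp add: saturated_def)
  have cls: "conjugacy_class perm_group f = {f. saturated f}"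
    unfolding conjugacy_class_eq[OF fG]
    using saturated_conjugate_to_each_other[OF conjunct1[OF R] f] saturated_conjugate[OF _ f] by blast
  have "gdelta_in perm_topology {f. saturated f}"
    unfolding sat using op by (intro gdelta_in_Inter[OF cD neD] open_imp_gdelta_in)
  moreover have "perm_topology closure_of {f. saturated f} = topspace perm_topology"
    unfolding dense_iff using sat_dense by blast
  ultimately show "\<exists>f\<in>G. perm_topology closure_of conjugacy_class perm_group f = topspace perm_topology \<and>
      gdelta_in perm_topology (conjugacy_class perm_group f)"
    using fG unfolding cls[symmetric] by blast
qed

end

section \<open>Embeddings of structures and automorphism groups\<close>

lemma map_tuples: "f ` univ A \<subseteq> univ B \<Longrightarrow> xs \<in> tuples n A \<Longrightarrow> map f xs \<in> tuples n B"
  by (auto simp: tuples_def)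

lemma embedding_comp:
  assumes f: "embedding L A B f" and g: "embedding L B C g"
  shows "embedding L A C (g \<circ> f)"
proof -
  have fi: "f ` univ A \<subseteq> univ B" using f by (simp add: embedding_def)
  have "inj_on (g \<circ> f) (univ A)"
    using f g fi by (auto simp: embedding_def intro: comp_inj_on inj_on_subset)
  moreover have "(g \<circ> f) ` univ A \<subseteq> univ C" using f g by (fastforce simp: embedding_def)
  moreover have "(g \<circ> f) (finterp A F xs) = finterp C F (map (g \<circ> f) xs)"
    if "F \<in> funs L" "xs \<in> tuples (farity L F) A" for F xs
    using f g that map_tuples[OF fi that(2)] by (simp add: embedding_def)
  moreover have "rinterp A R xs = rinterp C R (map (g \<circ> f) xs)"
    if "R \<in> rels L" "xs \<in> tuples (rarity L R) A" for R xs
    using f g that map_tuples[OF fi that(2)] by (simp add: embedding_def)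
  ultimately show ?thesis unfolding embedding_def by blast
qed

lemma embedding_cong:
  assumes f: "embedding L A B f" and A: "L_structure L A" and eq: "\<And>x. x \<in> univ A \<Longrightarrow> g x = f x"
  shows "embedding L A B g"
proof -
  have m: "map g xs = map f xs" if "xs \<in> tuples n A" for xs n
    using that eq by (auto simp: tuples_def)
  have "g ` univ A = f ` univ A" "inj_on g (univ A) = inj_on f (univ A)"
    using eq by (auto intro!: inj_on_cong)
  moreover have "finterp A F xs \<in> univ A" if "F \<in> funs L" "xs \<in> tuples (farity L F) A" for F xs
    using A that by (simp add: L_structure_def)
  ultimately show ?thesis using f eq unfolding embedding_def by (simp add: m del: map_eq_conv)
qed

lemma embedding_id: "substructure L B A \<Longrightarrow> embedding L B A (\<lambda>x. x)"
  by (simp add: substructure_def embedding_def)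

lemma embedding_substructure:
  assumes "substructure L B A" "embedding L A C f"
  shows "embedding L B C f"
  using embedding_comp[OF embedding_id[OF assms(1)] assms(2)] by (simp add: comp_def)

lemma isomorphism_comp: "isomorphism L A B f \<Longrightarrow> isomorphism L B C g \<Longrightarrow> isomorphism L A C (g \<circ> f)"
  unfolding isomorphism_def by (metis embedding_comp image_comp)

lemma isomorphism_cong:
  "isomorphism L A B f \<Longrightarrow> L_structure L A \<Longrightarrow> (\<And>x. x \<in> univ A \<Longrightarrow> g x = f x) \<Longrightarrow> isomorphism L A B g"
  unfolding isomorphism_def by (metis embedding_cong image_cong)

text \<open>Closure under the operations is transported along a bijection even though nothing is assumed of the
  target; in particular the image of an embedding is closed under the operations.\<close>

lemma isomorphism_structure:
  assumes f: "isomorphism L A B f" and A: "L_structure L A"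
  shows "L_structure L B"
  unfolding L_structure_def
proof (intro ballI)
  fix F ys assume F: "F \<in> funs L" and ys: "ys \<in> tuples (farity L F) B"
  have im: "f ` univ A = univ B" using f by (simp add: isomorphism_def)
  define xs where "xs = map (inv_into (univ A) f) ys"
  have xs: "xs \<in> tuples (farity L F) A" and "map f xs = ys"
    using ys im by (auto simp: tuples_def xs_def map_idI f_inv_into_f inv_into_into subset_iff)
  then have "finterp B F ys = f (finterp A F xs)" "finterp A F xs \<in> univ A"
    using f F A by (auto simp: isomorphism_def embedding_def L_structure_def)
  then show "finterp B F ys \<in> univ B" using im by auto
qed

lemma isomorphism_inv:
  assumes f: "isomorphism L A B f" and A: "L_structure L A"
  shows "isomorphism L B A (inv_into (univ A) f)"
proof -
  let ?g = "inv_into (univ A) f"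
  have im: "f ` univ A = univ B" and inj: "inj_on f (univ A)"
    and fF: "\<And>F xs. F \<in> funs L \<Longrightarrow> xs \<in> tuples (farity L F) A \<Longrightarrow> f (finterp A F xs) = finterp B F (map f xs)"
    and fR: "\<And>R xs. R \<in> rels L \<Longrightarrow> xs \<in> tuples (rarity L R) A \<Longrightarrow> rinterp A R xs = rinterp B R (map f xs)"
    using f by (auto simp: isomorphism_def embedding_def)
  have g: "map ?g ys \<in> tuples n A" "map f (map ?g ys) = ys" if "ys \<in> tuples n B" for ys n
    using that im by (auto simp: tuples_def map_idI f_inv_into_f inv_into_into subset_iff)
  have "?g (finterp B F ys) = finterp A F (map ?g ys)" if "F \<in> funs L" "ys \<in> tuples (farity L F) B" for F ys
  proof -
    have "finterp B F ys = f (finterp A F (map ?g ys))" using fF[OF that(1) g(1)[OF that(2)]] g(2)[OF that(2)] by simp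
    moreover have "finterp A F (map ?g ys) \<in> univ A" using A g(1)[OF that(2)] that by (simp add: L_structure_def)
    ultimately show ?thesis using inj by simp
  qed
  moreover have "rinterp B R ys = rinterp A R (map ?g ys)" if "R \<in> rels L" "ys \<in> tuples (rarity L R) B" for R ys
    using fR[OF that(1) g(1)[OF that(2)]] g(2)[OF that(2)] by simp
  moreover have "?g ` univ B = univ A" using im inj by (metis inv_into_image_cancel order_refl)
  moreover have "inj_on ?g (univ B)" using im by (simp add: inj_on_inv_into)
  ultimately show ?thesis unfolding isomorphism_def embedding_def by simp
qed

lemma isomorphism_image:
  assumes "embedding L P M \<alpha>"
  shows "isomorphism L P (M\<lparr>univ := \<alpha> ` univ P\<rparr>) \<alpha>"
  using assms by (auto simp: isomorphism_def embedding_def)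

lemma embedding_into:
  assumes "embedding L P M \<alpha>" "\<alpha> ` univ P \<subseteq> X"
  shows "embedding L P (M\<lparr>univ := X\<rparr>) \<alpha>"
  using assms by (auto simp: embedding_def)

lemma restrict_substructure:
  assumes "L_structure L M" "L_structure L (M\<lparr>univ := X\<rparr>)" "X \<subseteq> univ M"
  shows "substructure L (M\<lparr>univ := X\<rparr>) M"
  using assms by (simp add: substructure_def)

lemma generated_closed: "L_structure L (M\<lparr>univ := generated L M S\<rparr>)"
  by (auto simp: L_structure_def tuples_def intro!: generated.app)

lemma generated_subset:
  assumes "L_structure L M" "S \<subseteq> univ M"
  shows "generated L M S \<subseteq> univ M"
proof
  fix x assume "x \<in> generated L M S"
  then show "x \<in> univ M"
    by induction (use assms in \<open>auto simp: L_structure_def tuples_def subset_iff\<close>)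
qed

text \<open>Closedness holds because preserving one instance of a function or relation symbol involves only
  finitely many points, on which the limit agrees with an automorphism.\<close>

lemma Aut_closed_permutation_group:
  fixes M :: "('f, 'r, 'a) struct"
  assumes M: "L_structure L M" and "countable (univ M)"
  shows "closed_permutation_group (univ M) (Aut L M)"
proof (rule closed_permutation_group.intro)
  let ?U = "univ M"
  have iso: "isomorphism L M M g" if "g \<in> Aut L M" for g using that by (simp add: Aut_def)
  have bij: "g \<in> Bij ?U" if "g \<in> Aut L M" for g using that by (simp add: Aut_def)
  show "countable ?U" by fact
  show "subgroup (Aut L M) (BijGroup ?U)"
  proof (rule group.subgroupI[OF group_BijGroup])
    show "Aut L M \<subseteq> carrier (BijGroup ?U)" using bij by (auto simp: BijGroup_def)
    have "substructure L M M" using M by (simp add: substructure_def)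
    then have "isomorphism L M M (\<lambda>x. x)" using embedding_id by (auto simp: isomorphism_def)
    then have "isomorphism L M M (\<lambda>x\<in>?U. x)" by (rule isomorphism_cong[OF _ M]) simp
    then have "(\<lambda>x\<in>?U. x) \<in> Aut L M" by (simp add: Aut_def id_Bij)
    then show "Aut L M \<noteq> {}" by blast
  next
    fix g assume g: "g \<in> Aut L M"
    have "isomorphism L M M (restrict (inv_into ?U g) ?U)"
      by (rule isomorphism_cong[OF isomorphism_inv[OF iso[OF g] M] M]) simp
    then show "inv\<^bsub>BijGroup ?U\<^esub> g \<in> Aut L M"
      using bij[OF g] by (simp add: inv_BijGroup Aut_def restrict_inv_into_Bij)
  next
    fix g h assume gh: "g \<in> Aut L M" "h \<in> Aut L M"
    have "isomorphism L M M (compose ?U g h)"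
      by (rule isomorphism_cong[OF isomorphism_comp[OF iso[OF gh(2)] iso[OF gh(1)]] M]) (simp add: compose_def)
    then show "g \<otimes>\<^bsub>BijGroup ?U\<^esub> h \<in> Aut L M"
      using bij gh by (simp add: BijGroup_def Aut_def compose_Bij)
  qed
  fix g assume g: "g \<in> Bij ?U"
    and appr: "\<And>S. finite S \<Longrightarrow> S \<subseteq> ?U \<Longrightarrow> \<exists>h\<in>Aut L M. \<forall>x\<in>S. h x = g x"
  have fin: "finite (set xs)" "set xs \<subseteq> ?U" if "xs \<in> tuples n M" for xs n
    using that by (auto simp: tuples_def)
  have "g (finterp M F xs) = finterp M F (map g xs)" if F: "F \<in> funs L" and xs: "xs \<in> tuples (farity L F) M" for F xs
  proof -
    have "finterp M F xs \<in> ?U" using M F xs by (simp add: L_structure_def)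
    then obtain h where h: "h \<in> Aut L M" "\<forall>x\<in>insert (finterp M F xs) (set xs). h x = g x"
      using appr[of "insert (finterp M F xs) (set xs)"] fin[OF xs] by auto
    then have "map h xs = map g xs" by simp
    moreover have "h (finterp M F xs) = finterp M F (map h xs)"
      using F xs iso[OF h(1)] by (simp add: isomorphism_def embedding_def)
    ultimately show ?thesis using h(2) by (metis insertI1)
  qed
  moreover have "rinterp M R xs = rinterp M R (map g xs)" if R: "R \<in> rels L" and xs: "xs \<in> tuples (rarity L R) M" for R xs
  proof -
    obtain h where h: "h \<in> Aut L M" "\<forall>x\<in>set xs. h x = g x" using appr[OF fin[OF xs]] by blast
    then have "map h xs = map g xs" by simp
    moreover have "rinterp M R xs = rinterp M R (map h xs)"
      using R xs iso[OF h(1)] by (simp add: isomorphism_def embedding_def)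
    ultimately show ?thesis by metis
  qed
  moreover have "g ` ?U = ?U" "inj_on g ?U" using g by (auto simp: Bij_def bij_betw_def)
  ultimately show "g \<in> Aut L M" using g by (simp add: Aut_def isomorphism_def embedding_def)
qed

section \<open>Systems realized in the Fraisse limit\<close>

lemma sys_substructures:
  assumes "S \<in> Kp L K"
  shows "substructure L (src S) (amb S)" "substructure L (tgt S) (amb S)"
    "isomorphism L (src S) (tgt S) (pmap S)" "L_structure L (src S)" "L_structure L (amb S)"
    "univ (src S) \<subseteq> univ (amb S)" "pmap S ` univ (src S) = univ (tgt S)" "univ (tgt S) \<subseteq> univ (amb S)"
  using assms by (auto simp: Kp_def substructure_def isomorphism_def)

locale fraisse_limit_structure =
  fixes L :: "('f, 'r) signature" and K :: "('f, 'r) class_of_structs" and M :: "('f, 'r, 'a) struct"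
  assumes limit: "fraisse_limit L K M"
begin

abbreviation "U \<equiv> univ M"
abbreviation "G \<equiv> Aut L M"

lemma M_structure: "L_structure L M"
  and M_countable: "countable U"
  and M_locally_finite: "locally_finite L M"
  and M_ultrahomogeneous: "ultrahomogeneous L M"
  and K_eq: "K = {A. L_structure L A \<and> finite (univ A) \<and> embeds L A M}"
  using limit by (auto simp: fraisse_limit_def)

sublocale closed_permutation_group U G
  using M_structure M_countable by (rule Aut_closed_permutation_group)

lemma Aut_embedding: "g \<in> G \<Longrightarrow> embedding L M M g"
  by (simp add: Aut_def isomorphism_def)

text \<open>The form in which ultrahomogeneity is used throughout: any two embeddings of a finite structure
  differ by an automorphism. The structure \<open>P\<close> may live on any type, in particular on \<open>nat\<close>.\<close>

lemma extend_to_automorphism: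
  assumes P: "L_structure L P" "finite (univ P)"
    and \<alpha>: "embedding L P M \<alpha>" and \<beta>: "embedding L P M \<beta>"
  obtains g where "g \<in> G" "\<And>x. x \<in> univ P \<Longrightarrow> g (\<alpha> x) = \<beta> x"
proof -
  let ?A = "M\<lparr>univ := \<alpha> ` univ P\<rparr>" and ?B = "M\<lparr>univ := \<beta> ` univ P\<rparr>"
  have a: "isomorphism L P ?A \<alpha>" and b: "isomorphism L P ?B \<beta>"
    using \<alpha> \<beta> by (auto intro: isomorphism_image)
  have "substructure L ?A M" "substructure L ?B M"
    using isomorphism_structure[OF a P(1)] isomorphism_structure[OF b P(1)] M_structure \<alpha> \<beta>
    by (auto intro!: restrict_substructure simp: embedding_def)
  moreover have "isomorphism L ?A ?B (\<beta> \<circ> inv_into (univ P) \<alpha>)"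
    by (rule isomorphism_comp[OF isomorphism_inv[OF a P(1)] b])
  moreover have "finite (univ ?A)" "finite (univ ?B)" using P by simp_all
  ultimately obtain g where g: "g \<in> G" "\<forall>x\<in>univ ?A. g x = (\<beta> \<circ> inv_into (univ P) \<alpha>) x"
    using M_ultrahomogeneous unfolding ultrahomogeneous_def by blast
  have "g (\<alpha> x) = \<beta> x" if "x \<in> univ P" for x
    using g(2) that \<alpha> by (simp add: embedding_def)
  then show ?thesis using that g(1) by blast
qed

text \<open>The universes of finite substructures, which by local finiteness are cofinal among the
  finite subsets.\<close>

definition finite_closed :: "'a set \<Rightarrow> bool" where
  "finite_closed X \<longleftrightarrow> finite X \<and> X \<subseteq> U \<and> L_structure L (M\<lparr>univ := X\<rparr>)"

lemma finite_closed_generated: "finite X \<Longrightarrow> X \<subseteq> U \<Longrightarrow> finite_closed (generated L M X)"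
  using M_locally_finite generated_subset[OF M_structure] generated_closed
  by (simp add: finite_closed_def locally_finite_def)

lemma finite_closed_hull:
  assumes "finite X" "X \<subseteq> U" obtains Y where "finite_closed Y" "X \<subseteq> Y"
  using that[OF finite_closed_generated[OF assms]] by (auto intro: generated.base)

lemma finite_closed_image:
  assumes "finite_closed X" "g \<in> G"
  shows "finite_closed (g ` X)" "isomorphism L (M\<lparr>univ := X\<rparr>) (M\<lparr>univ := g ` X\<rparr>) g"
proof -
  have "embedding L (M\<lparr>univ := X\<rparr>) M g"
    using assms Aut_embedding restrict_substructure[OF M_structure] embedding_substructure
    by (metis finite_closed_def)
  then show iso: "isomorphism L (M\<lparr>univ := X\<rparr>) (M\<lparr>univ := g ` X\<rparr>) g"
    using isomorphism_image[of L "M\<lparr>univ := X\<rparr>" M g] by simp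
  show "finite_closed (g ` X)"
    using assms isomorphism_structure[OF iso] by (auto simp: finite_closed_def)
qed

definition code :: "'a \<Rightarrow> nat" where "code = to_nat_on U"
definition decode :: "nat \<Rightarrow> 'a" where "decode = inv_into U code"

lemma code_inj: "inj_on code U"
  unfolding code_def using M_countable by (rule inj_on_to_nat_on)

lemma decode_code [simp]: "x \<in> U \<Longrightarrow> decode (code x) = x"
  unfolding decode_def using code_inj by simp

text \<open>An isomorphic copy over \<open>nat\<close> of the substructure with universe \<open>X\<close>, since members of the class have
  elements in \<open>nat\<close>. The interpretations do not depend on \<open>X\<close>, so inclusions of universes become
  substructure relations.\<close>

definition copy :: "'a set \<Rightarrow> ('f, 'r, nat) struct" where
  "copy X = \<lparr>univ = code ` X, finterp = (\<lambda>F xs. code (finterp M F (map decode xs))),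
     rinterp = (\<lambda>R xs. rinterp M R (map decode xs))\<rparr>"

lemma univ_copy [simp]: "univ (copy X) = code ` X"
  by (simp add: copy_def)

lemma copy_isomorphism:
  assumes "X \<subseteq> U" shows "isomorphism L (M\<lparr>univ := X\<rparr>) (copy X) code"
proof -
  have "map (\<lambda>x. decode (code x)) xs = xs" if "xs \<in> tuples n (M\<lparr>univ := X\<rparr>)" for xs n
    using that assms by (auto simp: tuples_def intro!: map_idI)
  then show ?thesis using inj_on_subset[OF code_inj assms]
    by (auto simp: isomorphism_def embedding_def copy_def comp_def)
qed

lemma copy_structure:
  assumes "finite_closed X" shows "L_structure L (copy X)" "finite (univ (copy X))"
  using isomorphism_structure[OF copy_isomorphism, of X] assms by (auto simp: finite_closed_def)

lemma decode_isomorphism: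
  assumes "finite_closed X" shows "isomorphism L (copy X) (M\<lparr>univ := X\<rparr>) decode"
proof -
  have X: "X \<subseteq> U" "L_structure L (M\<lparr>univ := X\<rparr>)" using assms by (auto simp: finite_closed_def)
  show ?thesis
  proof (rule isomorphism_cong[OF isomorphism_inv[OF copy_isomorphism[OF X(1)] X(2)]])
    fix n assume "n \<in> univ (copy X)"
    then obtain x where "x \<in> X" "n = code x" by auto
    then show "decode n = inv_into (univ (M\<lparr>univ := X\<rparr>)) code n"
      using X inj_on_subset[OF code_inj X(1)] by (auto simp: subset_iff)
  qed (use copy_structure[OF assms] in simp)
qed

lemma decode_embedding:
  assumes "finite_closed X" shows "embedding L (copy X) M decode"
proof -
  have "embedding L (M\<lparr>univ := X\<rparr>) M (\<lambda>x. x)"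
    using assms M_structure by (intro embedding_id restrict_substructure) (auto simp: finite_closed_def)
  from embedding_comp[OF _ this, of "copy X" decode] show ?thesis
    using decode_isomorphism[OF assms] by (simp add: isomorphism_def comp_def)
qed

lemma copy_in_K: "finite_closed X \<Longrightarrow> copy X \<in> K"
  using copy_structure decode_embedding unfolding K_eq embeds_def by blast

lemma copy_substructure: "finite_closed X \<Longrightarrow> finite_closed Y \<Longrightarrow> X \<subseteq> Y \<Longrightarrow> substructure L (copy X) (copy Y)"
  using copy_structure by (auto simp: substructure_def copy_def)

text \<open>The finite partial automorphism \<open>h\<close> restricted to \<open>B\<close>, inside the finite substructure \<open>A\<close>.\<close>

definition copy_system :: "('a \<Rightarrow> 'a) \<Rightarrow> 'a set \<Rightarrow> 'a set \<Rightarrow> ('f, 'r) system" where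
  "copy_system h B A = \<lparr>amb = copy A, src = copy B, tgt = copy (h ` B), pmap = (\<lambda>n. code (h (decode n)))\<rparr>"

lemma copy_system_simps [simp]:
  "amb (copy_system h B A) = copy A" "src (copy_system h B A) = copy B"
  "tgt (copy_system h B A) = copy (h ` B)" "pmap (copy_system h B A) = (\<lambda>n. code (h (decode n)))"
  by (simp_all add: copy_system_def)

lemma copy_system_in_Kp:
  assumes h: "h \<in> G" and A: "finite_closed A" and B: "finite_closed B" "B \<subseteq> A" "h ` B \<subseteq> A"
  shows "copy_system h B A \<in> Kp L K"
proof -
  note hB = finite_closed_image[OF B(1) h]
  have "h ` B \<subseteq> U" using hB by (simp add: finite_closed_def)
  then have "isomorphism L (copy B) (copy (h ` B)) (code \<circ> (h \<circ> decode))"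
    by (intro isomorphism_comp[OF _ copy_isomorphism] isomorphism_comp[OF decode_isomorphism[OF B(1)] hB(2)])
  then show ?thesis
    using copy_in_K A B hB by (simp add: Kp_def copy_substructure comp_def)
qed

definition realizes :: "(nat \<Rightarrow> 'a) \<Rightarrow> ('a \<Rightarrow> 'a) \<Rightarrow> ('f, 'r) system \<Rightarrow> bool" where
  "realizes e h S \<longleftrightarrow> embedding L (amb S) M e \<and> h \<in> G \<and> (\<forall>b\<in>univ (src S). h (e b) = e (pmap S b))"

lemma Kp_finite: "S \<in> Kp L K \<Longrightarrow> finite (univ (amb S))" "S \<in> Kp L K \<Longrightarrow> finite (univ (src S))"
  using K_eq by (auto simp: Kp_def)

lemma realizes_in:
  assumes "realizes e h S" "S \<in> Kp L K"
  shows "e ` univ (amb S) \<subseteq> U" "e ` univ (src S) \<subseteq> U"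
    "finite (e ` univ (amb S))" "finite (e ` univ (src S))" "e ` univ (src S) \<subseteq> e ` univ (amb S)"
proof -
  show 1: "e ` univ (amb S) \<subseteq> U" using assms by (simp add: realizes_def embedding_def)
  show 2: "e ` univ (src S) \<subseteq> e ` univ (amb S)" using sys_substructures(6)[OF assms(2)] by (rule image_mono)
  show "e ` univ (src S) \<subseteq> U" using 1 2 by (rule order_trans[rotated])
  show "finite (e ` univ (amb S))" "finite (e ` univ (src S))" using Kp_finite[OF assms(2)] by simp_all
qed

lemma realizes_decode:
  assumes "h \<in> G" "finite_closed A" "finite_closed B"
  shows "realizes decode h (copy_system h B A)"
  using assms decode_embedding by (auto simp: realizes_def finite_closed_def subset_iff)

lemma realizes_along:
  assumes S: "S \<in> Kp L K" and e: "embedding L (amb S) M e"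
  obtains h where "realizes e h S"
proof -
  note sub = sys_substructures[OF S]
  have "embedding L (src S) (amb S) (pmap S)"
    using embedding_comp[OF _ embedding_id[OF sub(2)]] sub(3) by (fastforce simp: isomorphism_def comp_def)
  then have "embedding L (src S) M (e \<circ> pmap S)" using e by (rule embedding_comp)
  with embedding_substructure[OF sub(1) e] obtain h where
    "h \<in> G" "\<And>x. x \<in> univ (src S) \<Longrightarrow> h (e x) = (e \<circ> pmap S) x"
    using extend_to_automorphism[OF sub(4) Kp_finite(2)[OF S]] by blast
  then have "realizes e h S" using e by (simp add: realizes_def)
  then show ?thesis by (rule that)
qed

lemma embeds_M: "S \<in> Kp L K \<Longrightarrow> \<exists>e. embedding L (amb S) M e"
  using K_eq by (auto simp: Kp_def embeds_def)

lemma realization_exists: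
  assumes "S \<in> Kp L K" obtains e h where "realizes e h S"
  using embeds_M[OF assms] realizes_along[OF assms] by metis

text \<open>Any placement of the larger system can be moved by an automorphism so that it extends the given
  placement of the smaller one. The new automorphism then agrees with the old one on the
  source of the smaller system, that is, it lies in a smaller basic open set.\<close>

lemma realization_extends:
  assumes S: "S \<in> Kp L K" and T: "T \<in> Kp L K" and r: "realizes e h S" and f: "sys_embedding L S T f"
  obtains e' h' where "realizes e' h' T" "\<forall>x\<in>univ (amb S). e' (f x) = e x"
    "h' \<in> nbhd h (e ` univ (src S))"
proof -
  note sub = sys_substructures[OF S]
  obtain d where d: "embedding L (amb T) M d" using embeds_M[OF T] by blast
  have fe: "embedding L (amb S) (amb T) f" using f by (simp add: sys_embedding_def)
  have "embedding L (amb S) M e" using r by (simp add: realizes_def)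
  then obtain g where g: "g \<in> G" "\<And>x. x \<in> univ (amb S) \<Longrightarrow> g ((d \<circ> f) x) = e x"
    using extend_to_automorphism[OF sub(5) Kp_finite(1)[OF S] embedding_comp[OF fe d]] by metis
  obtain h' where h': "realizes (g \<circ> d) h' T"
    using realizes_along[OF T embedding_comp[OF d Aut_embedding[OF g(1)]]] by blast
  have eq: "(g \<circ> d) (f x) = e x" if "x \<in> univ (amb S)" for x using g(2)[OF that] by simp
  have "h' (e x) = h (e x)" if x: "x \<in> univ (src S)" for x
  proof -
    have x': "x \<in> univ (amb S)" "pmap S x \<in> univ (amb S)" "f x \<in> univ (src T)"
      using x sub f by (auto simp: sys_embedding_def)
    have "h' (e x) = h' ((g \<circ> d) (f x))" using eq[OF x'(1)] by simp
    also have "\<dots> = (g \<circ> d) (pmap T (f x))" using h' x'(3) by (simp add: realizes_def)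
    also have "\<dots> = (g \<circ> d) (f (pmap S x))" using f x by (simp add: sys_embedding_def)
    also have "\<dots> = e (pmap S x)" using eq[OF x'(2)] .
    also have "\<dots> = h (e x)" using r x by (simp add: realizes_def)
    finally show ?thesis .
  qed
  then have "h' \<in> nbhd h (e ` univ (src S))" using h' by (simp add: nbhd_def realizes_def)
  then show ?thesis using that[of "g \<circ> d" h'] h' eq by blast
qed

text \<open>The converse direction of the dictionary: an automorphism near \<open>h\<close> yields a system over \<open>S\<close>.\<close>

lemma copy_system_embedding:
  assumes S: "S \<in> Kp L K" and r: "realizes e h S" and h': "h' \<in> nbhd h (e ` univ (src S))"
    and A: "finite_closed A" "e ` univ (amb S) \<subseteq> A" and B: "e ` univ (src S) \<subseteq> B"
  shows "sys_embedding L S (copy_system h' B A) (code \<circ> e)"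
proof -
  note sub = sys_substructures[OF S]
  have e: "embedding L (amb S) M e" using r by (simp add: realizes_def)
  have AU: "A \<subseteq> U" using A by (simp add: finite_closed_def)
  have move: "e (pmap S b) = h' (e b)" if "b \<in> univ (src S)" for b
    using that r h' by (simp add: realizes_def nbhd_def)
  have "embedding L (amb S) (copy A) (code \<circ> e)"
    using embedding_comp[OF embedding_into[OF e A(2)]] copy_isomorphism[OF AU]
    unfolding isomorphism_def by blast
  moreover have "(code \<circ> e) ` univ (src S) \<subseteq> univ (copy B)" using B by auto
  moreover have "(code \<circ> e) ` univ (tgt S) \<subseteq> univ (copy (h' ` B))"
    unfolding sub(7)[symmetric] using B move by auto
  moreover have "decode (code (e b)) = e b" if "b \<in> univ (src S)" for b
    using that realizes_in(2)[OF r S] by auto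
  ultimately show ?thesis using move by (simp add: sys_embedding_def)
qed

text \<open>A realization \<open>(e, u)\<close> of \<open>W\<close> extending the first system gives \<open>u\<close>. It also places the second
  system in \<open>M\<close>, in a position differing from the original by an automorphism \<open>l\<close>, and \<open>u\<close>
  extends the partial map in that position. Conjugating by the inverse of \<open>l\<close> moves it back. Where
  \<open>r\<close> and \<open>s\<close> agree, the two positions coincide and \<open>l\<close> is the identity.\<close>

lemma joint_embedding_gives_conjugation:
  assumes g: "g0 \<in> G" "g1 \<in> G"
    and c: "finite_closed A0" "finite_closed A1" "finite_closed T0" "finite_closed T1"
      "T0 \<subseteq> A0" "T1 \<subseteq> A1" "g0 ` T0 \<subseteq> A0" "g1 ` T1 \<subseteq> A1"
    and W: "W \<in> Kp L K"
    and r: "sys_embedding L (copy_system g0 T0 A0) W r" and s: "sys_embedding L (copy_system g1 T1 A1) W s"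
  obtains k u where "k \<in> G" "u \<in> nbhd g0 T0" "conjugate k u \<in> nbhd g1 T1"
    "\<forall>x\<in>A0 \<inter> A1. r (code x) = s (code x) \<longrightarrow> k x = x"
proof -
  have S0: "copy_system g0 T0 A0 \<in> Kp L K" and S1: "copy_system g1 T1 A1 \<in> Kp L K"
    using g c by (auto intro: copy_system_in_Kp)
  have sub: "A0 \<subseteq> U" "A1 \<subseteq> U" "T0 \<subseteq> U" "T1 \<subseteq> U" using c by (auto simp: finite_closed_def)
  have dT0: "decode ` univ (src (copy_system g0 T0 A0)) = T0"
    using sub by (force simp: image_image subset_iff)
  obtain e u where e: "realizes e u W"
    and er: "\<forall>x\<in>univ (amb (copy_system g0 T0 A0)). e (r x) = decode x"
    and u: "u \<in> nbhd g0 (decode ` univ (src (copy_system g0 T0 A0)))"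
    using realization_extends[OF S0 W realizes_decode[OF g(1) c(1,3)] r] .
  have u0: "u \<in> nbhd g0 T0" using u unfolding dT0 .
  then have uG: "u \<in> G" by (simp add: nbhd_def)
  have sE: "embedding L (copy A1) (amb W) s" using s by (simp add: sys_embedding_def)
  have eE: "embedding L (amb W) M e" using e by (simp add: realizes_def)
  obtain l where l: "l \<in> G" "\<And>x. x \<in> univ (copy A1) \<Longrightarrow> l (decode x) = (e \<circ> s) x"
    using extend_to_automorphism[OF copy_structure[OF c(2)] decode_embedding[OF c(2)] embedding_comp[OF sE eE]]
    by metis
  have lx: "l x = e (s (code x))" if "x \<in> A1" for x
    using l(2)[of "code x"] that sub by (auto simp: subset_iff)
  let ?k = "inverse_perm l"
  have "conjugate ?k u x = g1 x" if x: "x \<in> T1" for x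
  proof -
    have xU: "x \<in> U" "x \<in> A1" "g1 x \<in> A1" "g1 x \<in> U" using x sub c by auto
    have sx: "s (code x) \<in> univ (src W)" using s x by (auto simp: sys_embedding_def)
    have "u (l x) = u (e (s (code x)))" using lx xU by simp
    also have "\<dots> = e (pmap W (s (code x)))" using e sx by (simp add: realizes_def)
    also have "pmap W (s (code x)) = s (code (g1 x))"
    proof -
      have "s (pmap (copy_system g1 T1 A1) (code x)) = pmap W (s (code x))"
        using s x unfolding sys_embedding_def by simp
      then show ?thesis using xU by simp
    qed
    also have "e \<dots> = l (g1 x)" using lx xU by simp
    finally have "u (l x) = l (g1 x)" .
    then show ?thesis using l xU uG by (simp add: conjugate_at G_inverse)
  qed
  then have "conjugate ?k u \<in> nbhd g1 T1" using l uG by (simp add: nbhd_def G_conjugate G_inverse)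
  moreover have "?k x = x" if "x \<in> A0" "x \<in> A1" "r (code x) = s (code x)" for x
  proof -
    have xU: "x \<in> U" using that sub by auto
    have "e (r (code x)) = x" using er that(1) xU by simp
    then have "l x = x" using lx[OF that(2)] that(3) by simp
    then show ?thesis using inverse_left[OF l(1) xU] by simp
  qed
  ultimately show ?thesis using that[of ?k u] l u0 G_inverse by blast
qed

text \<open>The automorphism \<open>u\<close>, restricted to a large enough finite substructure, contains the first system as
  placed by \<open>e0\<close> and the second one as placed by \<open>k\<^sup>-\<^sup>1 e1\<close>.\<close>

lemma conjugation_gives_joint_embedding:
  assumes S: "S0 \<in> Kp L K" "S1 \<in> Kp L K" and r: "realizes e0 h0 S0" "realizes e1 h1 S1"
    and k: "k \<in> G" and u: "u \<in> nbhd h0 (e0 ` univ (src S0))" "conjugate k u \<in> nbhd h1 (e1 ` univ (src S1))"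
  obtains W where "W \<in> Kp L K" "sys_embedding L S0 W (code \<circ> e0)"
    "sys_embedding L S1 W (code \<circ> (inverse_perm k \<circ> e1))"
proof -
  let ?k = "inverse_perm k"
  have uG: "u \<in> G" using u by (simp add: nbhd_def)
  have hG: "h1 \<in> G" using r by (simp add: realizes_def)
  have kG: "?k \<in> G" using k by (rule G_inverse)
  note i0 = realizes_in[OF r(1) S(1)] and i1 = realizes_in[OF r(2) S(2)]
  have e1: "embedding L (amb S1) M e1" using r by (simp add: realizes_def)
  have r1: "realizes (?k \<circ> e1) (conjugate ?k h1) S1"
    unfolding realizes_def
  proof (intro conjI ballI)
    show "embedding L (amb S1) M (?k \<circ> e1)" using embedding_comp[OF e1 Aut_embedding[OF kG]] .
    show "conjugate ?k h1 \<in> G" using kG hG by (rule G_conjugate)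
    fix b assume b: "b \<in> univ (src S1)"
    then show "conjugate ?k h1 ((?k \<circ> e1) b) = (?k \<circ> e1) (pmap S1 b)"
      using r(2) i1(2) conjugate_apply[OF kG hG, of "e1 b"] by (auto simp: realizes_def)
  qed
  have u1: "u \<in> nbhd (conjugate ?k h1) ((?k \<circ> e1) ` univ (src S1))"
  proof -
    have "u (?k y) = conjugate ?k h1 (?k y)" if y: "y \<in> e1 ` univ (src S1)" for y
    proof -
      have yU: "y \<in> U" using y i1 by auto
      have "conjugate k u y = h1 y" using u(2) y unfolding nbhd_def by blast
      then have "k (u (?k y)) = h1 y" using conjugate_at[OF k uG yU] by simp
      then have "u (?k y) = ?k (h1 y)"
        using inverse_left[OF k, of "u (?k y)"] yU k uG by simp
      then show ?thesis using conjugate_apply[OF kG hG yU] by simp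
    qed
    then show ?thesis using uG by (auto simp: nbhd_def)
  qed
  have "finite (e0 ` univ (src S0) \<union> (?k \<circ> e1) ` univ (src S1))"
    "e0 ` univ (src S0) \<union> (?k \<circ> e1) ` univ (src S1) \<subseteq> U"
    using i0 realizes_in[OF r1 S(2)] by auto
  then obtain B where B: "finite_closed B" "e0 ` univ (src S0) \<union> (?k \<circ> e1) ` univ (src S1) \<subseteq> B"
    by (rule finite_closed_hull)
  have "finite (B \<union> u ` B \<union> e0 ` univ (amb S0) \<union> (?k \<circ> e1) ` univ (amb S1))"
    "B \<union> u ` B \<union> e0 ` univ (amb S0) \<union> (?k \<circ> e1) ` univ (amb S1) \<subseteq> U"
    using i0 realizes_in[OF r1 S(2)] B finite_closed_image[OF B(1) uG] by (auto simp: finite_closed_def)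
  then obtain A where A: "finite_closed A"
    "B \<union> u ` B \<union> e0 ` univ (amb S0) \<union> (?k \<circ> e1) ` univ (amb S1) \<subseteq> A"
    by (rule finite_closed_hull)
  have "copy_system u B A \<in> Kp L K"
    using A B uG by (intro copy_system_in_Kp) auto
  moreover have "sys_embedding L S0 (copy_system u B A) (code \<circ> e0)"
    using A B by (intro copy_system_embedding[OF S(1) r(1) u(1)]) auto
  moreover have "sys_embedding L S1 (copy_system u B A) (code \<circ> (?k \<circ> e1))"
    using A B by (intro copy_system_embedding[OF S(2) r1 u1]) auto
  ultimately show ?thesis by (rule that)
qed

section \<open>Joint embedding and weak amalgamation as mixing of conjugation\<close>

lemma copy_system_of_automorphism:
  assumes "g \<in> G" "finite X" "X \<subseteq> U" "finite Z" "Z \<subseteq> U"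
  obtains T A where "finite_closed T" "finite_closed A" "X \<subseteq> T" "Z \<subseteq> A" "T \<subseteq> A" "g ` T \<subseteq> A"
    "copy_system g T A \<in> Kp L K"
proof -
  obtain T where T: "finite_closed T" "X \<subseteq> T" using finite_closed_hull[OF assms(2,3)] .
  have "finite (Z \<union> T \<union> g ` T)" "Z \<union> T \<union> g ` T \<subseteq> U"
    using T assms finite_closed_image[OF T(1) assms(1)] by (auto simp: finite_closed_def)
  then obtain A where A: "finite_closed A" "Z \<union> T \<union> g ` T \<subseteq> A" by (rule finite_closed_hull)
  then have "Z \<subseteq> A" "T \<subseteq> A" "g ` T \<subseteq> A" by auto
  then show ?thesis using that T A(1) assms(1) by (blast intro: copy_system_in_Kp)
qed

lemma nbhd_mono: "S \<subseteq> T \<Longrightarrow> nbhd h T \<subseteq> nbhd h S"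
  by (auto simp: nbhd_def)

text \<open>Every basic open set below the one determined by a realization of \<open>S\<close> contains one that comes from a
  system over \<open>S\<close>, with ambient structure as large as desired.\<close>

lemma copy_system_refining:
  assumes S: "S \<in> Kp L K" and r: "realizes e h S"
    and V: "V \<in> basic" "V \<subseteq> nbhd h (e ` univ (src S))" and Z: "finite Z" "Z \<subseteq> U"
  obtains g T A where "g \<in> G" "nbhd g T \<subseteq> V" "finite_closed T" "finite_closed A" "T \<subseteq> A" "g ` T \<subseteq> A"
    "Z \<subseteq> A" "copy_system g T A \<in> Kp L K" "sys_embedding L S (copy_system g T A) (code \<circ> e)"
proof -
  note i = realizes_in[OF r S]
  obtain g X where X: "g \<in> G" "finite X" "X \<subseteq> U" "V = nbhd g X" using V(1) by (auto simp: basic_def)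
  have "finite (X \<union> e ` univ (src S))" "X \<union> e ` univ (src S) \<subseteq> U"
    "finite (Z \<union> e ` univ (amb S))" "Z \<union> e ` univ (amb S) \<subseteq> U" using X i Z by auto
  from copy_system_of_automorphism[OF X(1) this]
  obtain T A where T: "finite_closed T" "finite_closed A" "X \<union> e ` univ (src S) \<subseteq> T"
    "Z \<union> e ` univ (amb S) \<subseteq> A" "T \<subseteq> A" "g ` T \<subseteq> A" "copy_system g T A \<in> Kp L K" .
  have "g \<in> nbhd h (e ` univ (src S))" using V(2) X(4) self_nbhd[OF X(1)] by blast
  then have "sys_embedding L S (copy_system g T A) (code \<circ> e)"
    using T by (intro copy_system_embedding[OF S r]) auto
  moreover have "nbhd g T \<subseteq> V" unfolding X(4) using T(3) by (intro nbhd_mono) auto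
  ultimately show ?thesis using that X(1) T by blast
qed

text \<open>A basic open set is specified by a system, and moving a point of one set into the other by
  conjugation amounts to embedding both systems in a common one.\<close>

lemma mixing_iff_Kp_JEP: "mixing {} G \<longleftrightarrow> Kp_JEP L K"
proof
  assume mix: "mixing {} G"
  show "Kp_JEP L K"
    unfolding Kp_JEP_def
  proof (intro ballI)
    fix S0 S1 assume S: "S0 \<in> Kp L K" "S1 \<in> Kp L K"
    obtain e0 h0 where r0: "realizes e0 h0 S0" using realization_exists[OF S(1)] .
    obtain e1 h1 where r1: "realizes e1 h1 S1" using realization_exists[OF S(2)] .
    have "nbhd h0 (e0 ` univ (src S0)) \<in> basic" "nbhd h1 (e1 ` univ (src S1)) \<in> basic"
      using r0 r1 realizes_in[OF r0 S(1)] realizes_in[OF r1 S(2)] by (auto intro!: basicI simp: realizes_def)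
    then obtain k u where k: "k \<in> stab {}" "u \<in> nbhd h0 (e0 ` univ (src S0))"
      "conjugate k u \<in> nbhd h1 (e1 ` univ (src S1))"
      using mix basic_sub unfolding mixing_def by meson
    obtain W where "W \<in> Kp L K" "sys_embedding L S0 W (code \<circ> e0)"
      "sys_embedding L S1 W (code \<circ> (inverse_perm k \<circ> e1))"
      using conjugation_gives_joint_embedding[OF S r0 r1 stab_sub[OF k(1)] k(2,3)] .
    then show "\<exists>W\<in>Kp L K. (\<exists>f. sys_embedding L S0 W f) \<and> (\<exists>g. sys_embedding L S1 W g)" by blast
  qed
next
  assume jep: "Kp_JEP L K"
  show "mixing {} G"
    unfolding mixing_def
  proof (intro ballI impI)
    fix W0 W1 assume W: "W0 \<in> basic" "W1 \<in> basic"
    obtain g0 X0 where 0: "g0 \<in> G" "finite X0" "X0 \<subseteq> U" "W0 = nbhd g0 X0" using W by (auto simp: basic_def)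
    obtain g1 X1 where 1: "g1 \<in> G" "finite X1" "X1 \<subseteq> U" "W1 = nbhd g1 X1" using W by (auto simp: basic_def)
    obtain T0 A0 where S0: "finite_closed T0" "finite_closed A0" "X0 \<subseteq> T0" "T0 \<subseteq> A0" "g0 ` T0 \<subseteq> A0"
      "copy_system g0 T0 A0 \<in> Kp L K"
      using copy_system_of_automorphism[OF 0(1,2,3,2,3)] .
    obtain T1 A1 where S1: "finite_closed T1" "finite_closed A1" "X1 \<subseteq> T1" "T1 \<subseteq> A1" "g1 ` T1 \<subseteq> A1"
      "copy_system g1 T1 A1 \<in> Kp L K"
      using copy_system_of_automorphism[OF 1(1,2,3,2,3)] .
    obtain W r s where "W \<in> Kp L K" "sys_embedding L (copy_system g0 T0 A0) W r"
      "sys_embedding L (copy_system g1 T1 A1) W s"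
      using jep S0(6) S1(6) unfolding Kp_JEP_def by blast
    from joint_embedding_gives_conjugation[OF 0(1) 1(1) S0(2) S1(2) S0(1) S1(1) S0(4) S1(4) S0(5) S1(5) this]
    obtain k u where k: "k \<in> G" "u \<in> nbhd g0 T0" "conjugate k u \<in> nbhd g1 T1" by metis
    then have "u \<in> W0" "conjugate k u \<in> W1"
      using nbhd_mono[OF S0(3)] nbhd_mono[OF S1(3)] 0(4) 1(4) by blast+
    then show "\<exists>k\<in>stab {}. \<exists>u\<in>W0. conjugate k u \<in> W1" using k(1) by (auto simp: stab_def)
  qed
qed

text \<open>Under the dictionary, a mixing set relative to \<open>A\<close> below a given basic set is a system \<open>T\<close> over a
  given system \<open>S\<close> whose ambient structure covers \<open>A\<close>. Basic subsets of it are systems over \<open>T\<close>, and the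
  requirement that the conjugating automorphism fixes \<open>A\<close> is the commutation of the
  amalgamation diagram on \<open>S\<close>.\<close>

lemma local_mixing_iff_Kp_WAP:
  "(\<forall>A V. finite A \<and> A \<subseteq> U \<and> V \<in> basic \<longrightarrow> (\<exists>W\<in>basic. W \<subseteq> V \<and> mixing A W)) \<longleftrightarrow> Kp_WAP L K"
proof
  assume mix: "\<forall>A V. finite A \<and> A \<subseteq> U \<and> V \<in> basic \<longrightarrow> (\<exists>W\<in>basic. W \<subseteq> V \<and> mixing A W)"
  show "Kp_WAP L K"
    unfolding Kp_WAP_def
  proof (rule ballI)
    fix S assume S: "S \<in> Kp L K"
    obtain e h where r: "realizes e h S" using realization_exists[OF S] .
    note i = realizes_in[OF r S]
    have hG: "h \<in> G" using r by (simp add: realizes_def)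
    obtain V where V: "V \<in> basic" "V \<subseteq> nbhd h (e ` univ (src S))" "mixing (e ` univ (amb S)) V"
      using mix i(1,3) basicI[OF hG i(4,2)] by blast
    obtain h' T A where X: "h' \<in> G" "nbhd h' T \<subseteq> V" and T: "finite_closed T" "finite_closed A"
      "T \<subseteq> A" "h' ` T \<subseteq> A" "e ` univ (amb S) \<subseteq> A" "copy_system h' T A \<in> Kp L K"
      and e: "sys_embedding L S (copy_system h' T A) (code \<circ> e)"
      using copy_system_refining[OF S r V(1,2) i(3,1)] .
    let ?T = "copy_system h' T A"
    have TU: "T \<subseteq> U" "A \<subseteq> U" using T by (auto simp: finite_closed_def)
    have dT: "decode ` univ (src ?T) = T" using TU by (force simp: image_image subset_iff)
    have rT: "realizes decode h' ?T" using realizes_decode[OF X(1) T(2,1)] .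
    \<comment> \<open>A system over \<open>?T\<close>, realized over the canonical realization of \<open>?T\<close>, determines a basic subset
      of \<open>V\<close>.\<close>
    have inV: "h0 \<in> G \<and> nbhd h0 (e0 ` univ (src T0)) \<in> basic \<and> nbhd h0 (e0 ` univ (src T0)) \<subseteq> V"
      if T0: "T0 \<in> Kp L K" and f: "sys_embedding L ?T T0 f" and r0: "realizes e0 h0 T0"
        and ef: "\<forall>x\<in>univ (amb ?T). e0 (f x) = decode x" and h0: "h0 \<in> nbhd h' (decode ` univ (src ?T))"
      for T0 f e0 h0
    proof -
      have h0G: "h0 \<in> G" using r0 by (simp add: realizes_def)
      have "T \<subseteq> e0 ` univ (src T0)"
      proof
        fix x assume x: "x \<in> T"
        then have "f (code x) \<in> univ (src T0)" using f by (auto simp: sys_embedding_def)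
        moreover have "x \<in> A" "x \<in> U" using x T(3) TU by auto
        then have "e0 (f (code x)) = x" using ef by simp
        ultimately show "x \<in> e0 ` univ (src T0)" by (metis imageI)
      qed
      then have "nbhd h0 (e0 ` univ (src T0)) \<subseteq> nbhd h0 T" by (rule nbhd_mono)
      also have "\<dots> \<subseteq> V" using X(2) nbhd_recenter[of h0 h' T] h0 unfolding dT by blast
      finally show ?thesis using h0G realizes_in[OF r0 T0] by (auto intro: basicI)
    qed
    show "\<exists>T\<in>Kp L K. \<exists>e. sys_embedding L S T e \<and>
      (\<forall>T0\<in>Kp L K. \<forall>T1\<in>Kp L K. \<forall>f g. sys_embedding L T T0 f \<and> sys_embedding L T T1 g \<longrightarrow>
         (\<exists>U\<in>Kp L K. \<exists>r s. sys_embedding L T0 U r \<and> sys_embedding L T1 U s \<and>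
            (\<forall>x\<in>univ (amb S). r (f (e x)) = s (g (e x)))))"
    proof (rule bexI[of _ ?T], rule exI[of _ "code \<circ> e"], intro conjI ballI allI impI)
      fix T0 T1 f g assume T01: "T0 \<in> Kp L K" "T1 \<in> Kp L K"
        and fg: "sys_embedding L ?T T0 f \<and> sys_embedding L ?T T1 g"
      obtain e0 h0 where 0: "realizes e0 h0 T0" "\<forall>x\<in>univ (amb ?T). e0 (f x) = decode x"
        "h0 \<in> nbhd h' (decode ` univ (src ?T))"
        using realization_extends[OF T(6) T01(1) rT conjunct1[OF fg]] .
      obtain e1 h1 where 1: "realizes e1 h1 T1" "\<forall>x\<in>univ (amb ?T). e1 (g x) = decode x"
        "h1 \<in> nbhd h' (decode ` univ (src ?T))"
        using realization_extends[OF T(6) T01(2) rT conjunct2[OF fg]] .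
      note v0 = inV[OF T01(1) conjunct1[OF fg] 0] and v1 = inV[OF T01(2) conjunct2[OF fg] 1]
      obtain k u where k: "k \<in> stab (e ` univ (amb S))" "u \<in> nbhd h0 (e0 ` univ (src T0))"
        "conjugate k u \<in> nbhd h1 (e1 ` univ (src T1))"
        using V(3) v0 v1 unfolding mixing_def by meson
      obtain W where W: "W \<in> Kp L K" "sys_embedding L T0 W (code \<circ> e0)"
        "sys_embedding L T1 W (code \<circ> (inverse_perm k \<circ> e1))"
        using conjugation_gives_joint_embedding[OF T01 0(1) 1(1) stab_sub[OF k(1)] k(2,3)] .
      have "(code \<circ> e0) (f ((code \<circ> e) x)) = (code \<circ> (inverse_perm k \<circ> e1)) (g ((code \<circ> e) x))"
        if x: "x \<in> univ (amb S)" for x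
      proof -
        have "e x \<in> A" "e x \<in> U" using x T(5) TU by auto
        then have "e0 (f (code (e x))) = e x" "e1 (g (code (e x))) = e x"
          using 0(2) 1(2) by simp_all
        moreover have "inverse_perm k (e x) = e x"
          using stab_inverse[OF i(1) k(1)] x by (simp add: stab_def)
        ultimately show ?thesis by simp
      qed
      then show "\<exists>U\<in>Kp L K. \<exists>r s. sys_embedding L T0 U r \<and> sys_embedding L T1 U s \<and>
          (\<forall>x\<in>univ (amb S). r (f ((code \<circ> e) x)) = s (g ((code \<circ> e) x)))"
        using W by blast
    qed (use T e in auto)
  qed
next
  assume wap: "Kp_WAP L K"
  show "\<forall>A V. finite A \<and> A \<subseteq> U \<and> V \<in> basic \<longrightarrow> (\<exists>W\<in>basic. W \<subseteq> V \<and> mixing A W)"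
  proof (intro allI impI)
    fix A V assume AV: "finite A \<and> A \<subseteq> U \<and> V \<in> basic"
    obtain g X where X: "g \<in> G" "finite X" "X \<subseteq> U" "V = nbhd g X" using AV by (auto simp: basic_def)
    from copy_system_of_automorphism[OF X(1,2,3), of A] AV
    obtain T Y where T: "finite_closed T" "finite_closed Y" "X \<subseteq> T" "A \<subseteq> Y" "copy_system g T Y \<in> Kp L K"
      by metis
    let ?S = "copy_system g T Y"
    have TU: "T \<subseteq> U" "Y \<subseteq> U" using T by (auto simp: finite_closed_def)
    have dT: "decode ` univ (src ?S) = T" using TU by (force simp: image_image subset_iff)
    obtain S' \<iota> where S': "S' \<in> Kp L K" "sys_embedding L ?S S' \<iota>" and amalg:
      "\<forall>T0\<in>Kp L K. \<forall>T1\<in>Kp L K. \<forall>f g. sys_embedding L S' T0 f \<and> sys_embedding L S' T1 g \<longrightarrow>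
         (\<exists>U\<in>Kp L K. \<exists>r s. sys_embedding L T0 U r \<and> sys_embedding L T1 U s \<and>
            (\<forall>x\<in>univ (amb ?S). r (f (\<iota> x)) = s (g (\<iota> x))))"
      using bspec[OF wap[unfolded Kp_WAP_def] T(5)] by (elim bexE exE conjE) (rule that)
    obtain e h where r: "realizes e h S'" and e\<iota>: "\<forall>x\<in>univ (amb ?S). e (\<iota> x) = decode x"
      and h: "h \<in> nbhd g (decode ` univ (src ?S))"
      using realization_extends[OF T(5) S'(1) realizes_decode[OF X(1) T(2,1)] S'(2)] .
    note i = realizes_in[OF r S'(1)]
    \<comment> \<open>The points of \<open>X\<close> are already moved as prescribed by \<open>g\<close>; including them makes the containment
      in \<open>V\<close> immediate.\<close>
    define B where "B = e ` univ (src S') \<union> X"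
    have B: "finite B" "B \<subseteq> U" using i X by (auto simp: B_def)
    have hV: "h \<in> V" using h nbhd_mono[OF T(3)] X(4) unfolding dT by blast
    have hG: "h \<in> G" using r by (simp add: realizes_def)
    have sub: "nbhd h B \<subseteq> V"
      using nbhd_mono[of X B h] nbhd_recenter[of h g X] hV X(4) by (auto simp: B_def)
    have "mixing A (nbhd h B)"
      unfolding mixing_def
    proof (intro ballI impI)
      fix W0 W1 assume W: "W0 \<in> basic" "W1 \<in> basic" "W0 \<subseteq> nbhd h B \<and> W1 \<subseteq> nbhd h B"
      have "nbhd h B \<subseteq> nbhd h (e ` univ (src S'))" by (rule nbhd_mono) (simp add: B_def)
      then have W': "W0 \<subseteq> nbhd h (e ` univ (src S'))" "W1 \<subseteq> nbhd h (e ` univ (src S'))"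
        using W(3) by blast+
      have Y: "finite Y" using T(2) by (simp add: finite_closed_def)
      obtain g0 T0 A0 where 0: "g0 \<in> G" "nbhd g0 T0 \<subseteq> W0" and c0: "finite_closed T0" "finite_closed A0"
        "T0 \<subseteq> A0" "g0 ` T0 \<subseteq> A0" "Y \<subseteq> A0" "copy_system g0 T0 A0 \<in> Kp L K"
        and f0: "sys_embedding L S' (copy_system g0 T0 A0) (code \<circ> e)"
        using copy_system_refining[OF S'(1) r W(1) W'(1) Y TU(2)] .
      obtain g1 T1 A1 where 1: "g1 \<in> G" "nbhd g1 T1 \<subseteq> W1" and c1: "finite_closed T1" "finite_closed A1"
        "T1 \<subseteq> A1" "g1 ` T1 \<subseteq> A1" "Y \<subseteq> A1" "copy_system g1 T1 A1 \<in> Kp L K"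
        and f1: "sys_embedding L S' (copy_system g1 T1 A1) (code \<circ> e)"
        using copy_system_refining[OF S'(1) r W(2) W'(2) Y TU(2)] .
      obtain N p q where N: "N \<in> Kp L K" "sys_embedding L (copy_system g0 T0 A0) N p"
        "sys_embedding L (copy_system g1 T1 A1) N q"
        and pq: "\<forall>x\<in>univ (amb ?S). p ((code \<circ> e) (\<iota> x)) = q ((code \<circ> e) (\<iota> x))"
        using amalg[rule_format, OF c0(6) c1(6) conjI[OF f0 f1]] by blast
      obtain k u where k: "k \<in> G" "u \<in> nbhd g0 T0" "conjugate k u \<in> nbhd g1 T1"
        and kfix: "\<forall>x\<in>A0 \<inter> A1. p (code x) = q (code x) \<longrightarrow> k x = x"
        using joint_embedding_gives_conjugation[OF 0(1) 1(1) c0(2) c1(2) c0(1) c1(1) c0(3) c1(3) c0(4) c1(4) N] .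
      have "k x = x" if "x \<in> A" for x
      proof -
        have x: "x \<in> Y" "x \<in> U" using that T(4) TU by auto
        then have "e (\<iota> (code x)) = x" using e\<iota> by simp
        moreover have "p (code (e (\<iota> (code x)))) = q (code (e (\<iota> (code x))))" using pq x by simp
        ultimately show ?thesis using kfix x c0(5) c1(5) by auto
      qed
      then have "k \<in> stab A" using k(1) by (simp add: stab_def)
      then show "\<exists>k\<in>stab A. \<exists>u\<in>W0. conjugate k u \<in> W1" using k 0(2) 1(2) by blast
    qed
    then show "\<exists>W\<in>basic. W \<subseteq> V \<and> mixing A W" using sub basicI[OF hG B] by blast
  qed
qed

theorem generic_automorphism_iff:
  "(\<exists>f. generic_automorphism L M f) \<longleftrightarrow> Kp_JEP L K \<and> Kp_WAP L K"
  using dense_Gdelta_class_iff unfolding mixing_iff_Kp_JEP local_mixing_iff_Kp_WAP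
  by (simp add: generic_automorphism_def Aut_topology_def Aut_group_def Bex_def)

end

theorem theorem1p3:
  fixes L :: "('f, 'r) signature"
    and K :: "('f, 'r) class_of_structs"
    and M :: "('f, 'r, 'a) struct"
  assumes "countable_signature L"
    and "fraisse_class L K"
    and "fraisse_limit L K M"
  shows "(\<exists>f. generic_automorphism L M f) \<longleftrightarrow> Kp_JEP L K \<and> Kp_WAP L K"
  using fraisse_limit_structure.generic_automorphism_iff[OF fraisse_limit_structure.intro[OF assms(3)]] .

end
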